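(* Let $N\ge3$ be an integer, $1\le p<N$ and $q>p^{\ast}=\frac{Np}{N-p}$. Then there is a positive function $u:\mathbb{Z}^N\to(0,\infty)$ solving $$\Delta_p u+u^{q-1}=0\quad\text{on }\mathbb{Z}^N,$$ where for $p>1$ this means $\Delta_pu(x)+u(x)^{q-1}=0$ for every $x\in\mathbb{Z}^N$, and for $p=1$ (where $\Delta_1$ is set-valued) it means that there is a family $(f_{xy})_{x\sim y}$ with $f_{xy}=-f_{yx}$ and $f_{xy}\in\operatorname{sign}(u(y)-u(x))$ such that $\sum_{y\sim x}f_{xy}+u(x)^{q-1}=0$ for every $x\in\mathbb{Z}^N$.
   Context: $\mathbb{Z}^N$ is the integer lattice graph: $x\sim y$ iff $\sum_{k=1}^N|x_k-y_k|=1$. For $u:\mathbb{Z}^N\to\mathbb{R}$ and $p>1$, the $p$-Laplacian is $$\Delta_pu(x):=\sum_{y\sim x}|u(y)-u(x)|^{p-2}(u(y)-u(x)),$$ (terms with $u(y)=u(x)$ being $0$), and for $p=1$, $$\Delta_1u(x):=\left\{\sum_{y\sim x}f_{xy} : f_{xy}=-f_{yx},\ f_{xy}\in\operatorname{sign}(u(y)-u(x))\right\},$$ where $\operatorname{sign}(a)=\{1\}$ if $a>0$, $\operatorname{sign}(0)=[-1,1]$, and $\operatorname{sign}(a)=\{-1\}$ if $a<0$. *)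

theory Defs
  imports "HOL-Analysis.Analysis"
begin

definition lattice_adj :: "int ^ 'n::finite \<Rightarrow> int ^ 'n \<Rightarrow> bool" (infix \<open>\<sim>\<^sub>Z\<close> 50)
  where "x \<sim>\<^sub>Z y \<longleftrightarrow> (\<Sum>k\<in>UNIV. \<bar>x $ k - y $ k\<bar>) = 1"

text \<open>Sums over neighbours are genuine finite sums, not the default value 0 of an
  infinite sum.\<close>

lemma finite_neighbours: "finite {y. x \<sim>\<^sub>Z y}"
  for x :: "int ^ 'n::finite"
proof (rule finite_subset)
  let ?F = "PiE UNIV (\<lambda>k. {x $ k - 1 .. x $ k + 1})"
  show "finite (vec_lambda ` ?F)"
    by (intro finite_imageI finite_PiE) auto
  show "{y. x \<sim>\<^sub>Z y} \<subseteq> vec_lambda ` ?F"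
  proof
    fix y assume "y \<in> {y. x \<sim>\<^sub>Z y}"
    then have s: "(\<Sum>k\<in>UNIV. \<bar>x $ k - y $ k\<bar>) = 1"
      by (simp add: lattice_adj_def)
    have "\<bar>x $ k - y $ k\<bar> \<le> 1" for k
      using member_le_sum[of k UNIV "\<lambda>k. \<bar>x $ k - y $ k\<bar>"] s by simp
    then have "y $ k \<in> {x $ k - 1 .. x $ k + 1}" for k
      by (smt (verit) atLeastAtMost_iff)
    then have "vec_nth y \<in> ?F" by auto
    then show "y \<in> vec_lambda ` ?F"
      by (metis image_eqI vec_nth_inverse)
  qed
qed

text \<open>Meant for \<open>p > 1\<close>. Terms with \<open>u y = u x\<close> vanish, also for \<open>p < 2\<close>,
  because \<open>0 powr a = 0\<close>.\<close>

definition p_laplacian :: "real \<Rightarrow> (int ^ 'n::finite \<Rightarrow> real) \<Rightarrow> int ^ 'n \<Rightarrow> real"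
  where "p_laplacian p u x =
    (\<Sum>y | x \<sim>\<^sub>Z y. \<bar>u y - u x\<bar> powr (p - 2) * (u y - u x))"

definition sign_set :: "real \<Rightarrow> real set"
  where "sign_set a = (if a > 0 then {1} else if a < 0 then {-1} else {-1..1})"

text \<open>An admissible family for the set-valued 1-Laplacian. The values of \<open>f\<close> on
  non-adjacent pairs are unconstrained and never used.\<close>

definition sign_family ::
    "(int ^ 'n::finite \<Rightarrow> real) \<Rightarrow> (int ^ 'n \<Rightarrow> int ^ 'n \<Rightarrow> real) \<Rightarrow> bool"
  where "sign_family u f \<longleftrightarrow>
    (\<forall>x y. x \<sim>\<^sub>Z y \<longrightarrow> f x y = - f y x \<and> f x y \<in> sign_set (u y - u x))"

end

theory Submission
  imports Defs "HOL-Complex_Analysis.Great_Picard"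
begin

text \<open>
  Write \<open>N\<close> for the dimension. The cases \<open>p > 1\<close> and \<open>p = 1\<close> have different reasons.

  For \<open>p > 1\<close> the solution is a limit of functions that nearly minimise the energy
  \<open>E u\<close>, the sum of \<open>\<bar>u y - u x\<bar> powr p\<close> over the edges, among the finitely supported \<open>u\<close>
  with \<open>\<Sum>\<bar>u x\<bar> powr q = 1\<close>. Two facts are needed: the infimum \<open>S\<close> is positive, and a
  minimising sequence does not spread out and vanish. Both follow from a Sobolev
  inequality for all exponents above the critical \<open>p* = N * p / (N - p)\<close>
  (\<open>supercritical_sobolev\<close>): as \<open>q > p*\<close>, it applies to \<open>q\<close> itself, which gives \<open>S > 0\<close>,
  and to some \<open>r < q\<close>. Then \<open>1 = \<Sum> u powr q \<le> (sup u) powr (q - r) * \<Sum> u powr r\<close> bounds the supremum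
  of a near minimiser from below, so that after a translation its value at the origin
  is bounded below (\<open>near_minimizers_at_origin\<close>), and a subsequence converges pointwise to some
  \<open>u \<noteq> 0\<close>. The energy is not known to be continuous under this convergence, but that does not
  matter: changing a function at a single point \<open>x\<close> by \<open>t\<close> changes its energy and its
  \<open>q\<close>-mass by expressions that involve only \<open>x\<close> and its neighbours. The inequality
  \<open>S * (\<Sum>\<bar>w\<bar> powr q) powr (p / q) \<le> E w\<close> for the changed near minimisers therefore passes to
  the limit; there it is an equality at \<open>t = 0\<close>, and its derivative at \<open>t = 0\<close> is the
  equation with the multiplier \<open>S\<close> (\<open>euler_lagrange_of_minimum\<close>). The strong maximum principle
  gives \<open>u > 0\<close> and a scaling removes \<open>S\<close>.

  For \<open>p = 1\<close> the maximum principle fails: an extremal function may be a multiple of the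
  indicator of a finite set. Instead there is an explicit solution. Exhaust the
  lattice by boxes, beginning with one point and adding at each time a slab, a copy of
  one face. Let a unit flow leave each box through every boundary edge. Across a
  new slab, normally to it, this flow passes without divergence; parallel to it, it can be
  interpolated linearly from \<open>-1\<close> to \<open>1\<close>, which in a direction of side length \<open>a\<close> yields the
  constant divergence \<open>2 / a\<close>. So the divergence is constant on each slab, and if the
  faces are used cyclically, it never increases in time. A function \<open>u\<close> whose power
  \<open>u powr (q - 1)\<close> is this divergence then never increases along the flow, as the sign condition
  demands.
\<close>

section \<open>The lattice graph\<close>

lemma adj_iff_axis: "x \<sim>\<^sub>Z y \<longleftrightarrow> (\<exists>i. y = x + axis i 1 \<or> y = x - axis i 1)"
  for x y :: "int ^ 'n::finite"
proof
  assume "x \<sim>\<^sub>Z y"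
  then have s: "(\<Sum>k\<in>UNIV. \<bar>x $ k - y $ k\<bar>) = 1"
    by (simp add: lattice_adj_def)
  then obtain i where i: "x $ i \<noteq> y $ i"
    by (metis (no_types, lifting) abs_zero cancel_comm_monoid_add_class.diff_cancel sum.neutral zero_neq_one)
  have "(\<Sum>k\<in>UNIV. \<bar>x $ k - y $ k\<bar>) = \<bar>x $ i - y $ i\<bar> + (\<Sum>k\<in>UNIV - {i}. \<bar>x $ k - y $ k\<bar>)"
    by (simp add: sum.remove)
  moreover have "(\<Sum>k\<in>UNIV - {i}. \<bar>x $ k - y $ k\<bar>) \<ge> 0"
    by (simp add: sum_nonneg)
  ultimately have 1: "\<bar>x $ i - y $ i\<bar> = 1" and "(\<Sum>k\<in>UNIV - {i}. \<bar>x $ k - y $ k\<bar>) = 0"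
    using s i by linarith+
  then have 0: "x $ k = y $ k" if "k \<noteq> i" for k
    using that by (subst (asm) sum_nonneg_eq_0_iff) auto
  from 1 have "y $ i = x $ i + 1 \<or> y $ i = x $ i - 1" by linarith
  then have "y = x + axis i 1 \<or> y = x - axis i 1"
    using 0 by (auto simp: vec_eq_iff axis_def)
  then show "\<exists>i. y = x + axis i 1 \<or> y = x - axis i 1" ..
next
  assume "\<exists>i. y = x + axis i 1 \<or> y = x - axis i 1"
  then obtain i where "y = x + axis i 1 \<or> y = x - axis i 1" ..
  then have "\<bar>x $ k - y $ k\<bar> = (if k = i then 1 else 0)" for k
    by (auto simp: axis_def)
  then show "x \<sim>\<^sub>Z y" by (simp add: lattice_adj_def)
qed

lemma sum_neighbours:
  fixes x :: "int ^ 'n::finite" and g :: "int ^ 'n \<Rightarrow> real"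
  shows "(\<Sum>y | x \<sim>\<^sub>Z y. g y) = (\<Sum>i\<in>UNIV. g (x + axis i 1) + g (x - axis i 1))"
proof -
  let ?P = "range (\<lambda>i. x + axis i 1)" and ?M = "range (\<lambda>i. x - axis i 1)"
  have eq: "{y. x \<sim>\<^sub>Z y} = ?P \<union> ?M" by (auto simp: adj_iff_axis)
  have "x + axis i 1 \<noteq> x - axis j 1" for i j :: 'n
    by (auto simp: vec_eq_iff axis_def intro!: exI[of _ i])
  then have "?P \<inter> ?M = {}" by blast
  then have "(\<Sum>y | x \<sim>\<^sub>Z y. g y) = sum g ?P + sum g ?M"
    unfolding eq by (intro sum.union_disjoint) auto
  also have "sum g ?P = (\<Sum>i\<in>UNIV. g (x + axis i 1))"
    by (subst sum.reindex) (auto simp: inj_on_def axis_eq_axis)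
  also have "sum g ?M = (\<Sum>i\<in>UNIV. g (x - axis i 1))"
    by (subst sum.reindex) (auto simp: inj_on_def axis_eq_axis)
  finally show ?thesis by (simp add: sum.distrib)
qed

lemma adj_sym: "x \<sim>\<^sub>Z y \<Longrightarrow> y \<sim>\<^sub>Z x"
  by (simp add: lattice_adj_def abs_minus_commute)

text \<open>
  The step of inductions on the distance to the origin.
\<close>

lemma closer_to_origin:
  fixes z :: "int ^ 'n::finite"
  assumes "z \<noteq> 0"
  obtains z' i where "z = z' + axis i 1 \<or> z = z' - axis i 1"
    "(\<Sum>k\<in>UNIV. \<bar>z $ k\<bar>) = (\<Sum>k\<in>UNIV. \<bar>z' $ k\<bar>) + 1"
proof -
  obtain i where i: "z $ i \<noteq> 0" using assms by (auto simp: vec_eq_iff)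
  define z' where "z' = (if z $ i > 0 then z - axis i 1 else z + axis i 1)"
  have z': "z' $ k = (if k = i then z $ i - sgn (z $ i) else z $ k)" for k
    using i by (auto simp: z'_def axis_def)
  have "(\<Sum>k\<in>UNIV. \<bar>z $ k\<bar>) = \<bar>z $ i\<bar> + (\<Sum>k\<in>UNIV - {i}. \<bar>z $ k\<bar>)"
    by (simp add: sum.remove)
  moreover have "(\<Sum>k\<in>UNIV. \<bar>z' $ k\<bar>) = \<bar>z' $ i\<bar> + (\<Sum>k\<in>UNIV - {i}. \<bar>z $ k\<bar>)"
    by (subst sum.remove[of _ i]) (auto simp: z' intro!: sum.cong)
  moreover have "\<bar>z $ i\<bar> = \<bar>z' $ i\<bar> + 1" using i by (auto simp: z' sgn_if)
  moreover have "z = z' + axis i 1 \<or> z = z' - axis i 1" by (simp add: z'_def)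
  ultimately show ?thesis by (intro that[of z' i]) auto
qed

lemma lattice_induct:
  fixes z :: "int ^ 'n::finite"
  assumes "P 0" and step: "\<And>x y. P x \<Longrightarrow> x \<sim>\<^sub>Z y \<Longrightarrow> P y"
  shows "P z"
proof (induction "nat (\<Sum>k\<in>UNIV. \<bar>z $ k\<bar>)" arbitrary: z rule: less_induct)
  case less
  show ?case
  proof (cases "z = 0")
    case False
    then obtain z' i where z: "z = z' + axis i 1 \<or> z = z' - axis i 1"
      and norm: "(\<Sum>k\<in>UNIV. \<bar>z $ k\<bar>) = (\<Sum>k\<in>UNIV. \<bar>z' $ k\<bar>) + 1"
      by (rule closer_to_origin)
    have "(\<Sum>k\<in>UNIV. \<bar>z' $ k\<bar>) \<ge> 0" by (simp add: sum_nonneg)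
    then have "P z'" using norm by (intro less) linarith
    then show ?thesis using z by (intro step[of z' z]) (auto simp: adj_iff_axis)
  qed (simp add: assms)
qed

section \<open>The case p = 1: a flow through growing boxes\<close>

text \<open>
  The intervals of \<open>1, 2, 3, ...\<close> points that grow from \<open>{0}\<close> alternately to the right and to
  the left are \<open>{0}, {0, 1}, {-1, 0, 1}, ...\<close>; the layer of an integer is the size of the first
  of them that contains it.
\<close>

definition layer :: "int \<Rightarrow> nat" where
  "layer z = nat (if z > 0 then 2 * z else 1 - 2 * z)"

lemma layer_ge_1: "1 \<le> layer z" by (auto simp: layer_def)

text \<open>
  The interval of \<open>a\<close> points has the centre \<open>c / 2\<close> with \<open>c = 1\<close> for even \<open>a\<close> and \<open>c = 0\<close> for
  odd \<open>a\<close>. This is the flow along the edge from \<open>z\<close> to \<open>z'\<close> that points away from the centre and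
  is linear in the midpoint of the edge, normalised to be \<open>1\<close> on the two edges that leave
  the interval. The factor \<open>z' - z\<close> makes it skew-symmetric.
\<close>

definition slab_flow :: "nat \<Rightarrow> int \<Rightarrow> int \<Rightarrow> real" where
  "slab_flow a z z' = of_int ((z' - z) * (z + z' - (if even a then 1 else 0))) / real a"

lemma slab_flow_skew: "slab_flow a z z' = - slab_flow a z' z"
proof -
  have "(z' - z) * (z + z' - c) = - ((z - z') * (z' + z - c))" for c
    by (simp add: algebra_simps)
  then show ?thesis by (simp only: slab_flow_def of_int_minus minus_divide_left)
qed

lemma slab_flow_refl: "slab_flow a z z = 0"
  by (simp add: slab_flow_def)

lemma slab_flow_inside:
  assumes "layer z \<le> a" "layer z' \<le> a" "\<bar>z' - z\<bar> = 1"
  shows "\<bar>slab_flow a z z'\<bar> \<le> 1"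
proof -
  have "\<bar>(z' - z) * (z + z' - (if even a then 1 else 0))\<bar> \<le> int a"
    unfolding abs_mult assms(3) using assms
    by (cases "even a") (auto simp: layer_def abs_le_iff elim!: evenE oddE split: if_splits)
  then have "\<bar>real_of_int ((z' - z) * (z + z' - (if even a then 1 else 0)))\<bar> \<le> real a"
    by linarith
  then show ?thesis unfolding slab_flow_def abs_divide
    using layer_ge_1[of z] assms(1) by (simp add: divide_le_eq)
qed

lemma layer_le_iff: "1 \<le> a \<Longrightarrow> layer z \<le> a \<longleftrightarrow> 1 - int a \<le> 2 * z \<and> 2 * z \<le> int a"
  by (auto simp: layer_def)

lemma slab_flow_exit:
  assumes "layer z \<le> a" "a < layer z'" "\<bar>z' - z\<bar> = 1"
  shows "slab_flow a z z' = 1"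
proof -
  have a: "1 \<le> a" using layer_ge_1[of z] assms(1) by linarith
  have in_out: "1 - int a \<le> 2 * z \<and> 2 * z \<le> int a" "\<not> (1 - int a \<le> 2 * z' \<and> 2 * z' \<le> int a)"
    using assms(1,2) layer_le_iff[OF a, of z] layer_le_iff[OF a, of z'] by linarith+
  have "(z' - z) * (z + z' - (if even a then 1 else 0)) = int a"
  proof -
    from assms(3) have "z' = z + 1 \<or> z' = z - 1" by linarith
    then show ?thesis
    proof
      assume z': "z' = z + 1"
      have "2 * z + 1 - (if even a then 1 else 0) = int a"
        using in_out unfolding z' by (cases "even a") (auto elim!: evenE oddE)
      then show ?thesis by (simp add: z')
    next
      assume z': "z' = z - 1"
      have "(if even a then 1 else 0) - (2 * z - 1) = int a"
        using in_out unfolding z' by (cases "even a") (auto elim!: evenE oddE, presburger+)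
      then show ?thesis by (simp add: z')
    qed
  qed
  then show ?thesis unfolding slab_flow_def using a by simp
qed

lemma slab_flow_divergence:
  "slab_flow a z (z + 1) + slab_flow a z (z - 1) = 2 / real a"
  by (simp add: slab_flow_def algebra_simps flip: add_divide_distrib)

lemma layer_step:
  assumes "layer z \<noteq> 1"
  shows "(layer (z + 1) < layer z \<and> layer z < layer (z - 1)) \<or>
         (layer (z - 1) < layer z \<and> layer z < layer (z + 1))"
  using assms by (auto simp: layer_def)

lemma layer_eq_1_iff: "layer z = Suc 0 \<longleftrightarrow> z = 0"
  by (auto simp: layer_def)

text \<open>
  If \<open>t = N * M + m\<close> with \<open>m < N\<close>, then the slab that arrives at time \<open>t\<close> has \<open>m\<close> side lengths
  \<open>M\<close> and \<open>N - 1 - m\<close> side lengths \<open>M - 1\<close>, so this is the sum of \<open>2 / a\<close> over its side lengths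
  \<open>a\<close>. The origin arrives at \<open>t = 2 * N - 1\<close>, where \<open>M = 1\<close>; flow leaves it in both
  senses of the remaining direction too, hence the last summand.
\<close>

definition rate :: "nat \<Rightarrow> nat \<Rightarrow> real" where
  "rate N t = 2 * real (t mod N) / real (t div N)
     + 2 * real (N - 1 - t mod N) / real (t div N - 1)
     + (if t div N = 1 then 2 else 0)"

text \<open>
  Passing from \<open>t\<close> to \<open>t + 1\<close> replaces one side length \<open>M - 1\<close> by \<open>M\<close>, except at the end of a
  cycle, where all side lengths are \<open>M\<close> before and after. The last summand of the rate can only disappear.
\<close>

lemma rate_Suc_le:
  assumes N: "0 < N" and t: "2 * N - 1 \<le> t"
  shows "rate N (Suc t) \<le> rate N t"
proof -
  define M where "M = t div N"
  define m where "m = t mod N"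
  have tt: "t = N * M + m" by (simp add: M_def m_def)
  have mN: "m < N" using N by (simp add: m_def)
  have M1: "M \<ge> 1"
  proof (rule ccontr)
    assume "\<not> M \<ge> 1"
    then show False using tt t mN by (cases M) auto
  qed
  show ?thesis
  proof (cases "Suc m = N")
    case True
    then have "Suc t = N * Suc M" using tt by simp
    then have "Suc t div N = Suc M" "Suc t mod N = 0"
      using N by (metis nonzero_mult_div_cancel_left neq0_conv, metis mod_mult_self1_is_0)
    moreover have "N - 1 = m" using True by simp
    ultimately show ?thesis
      using M1 by (simp add: rate_def flip: M_def m_def)
  next
    case False
    then have Sm: "Suc m < N" using mN by simp
    have "Suc t = N * M + Suc m" using tt by simp
    then have S: "Suc t div N = M" "Suc t mod N = Suc m"
      using Sm by (metis div_mult_self4 div_less add_0_right N neq0_conv, metis mod_mult_self4 mod_less)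
    have M2: "M \<ge> 2"
    proof (rule ccontr)
      assume "\<not> M \<ge> 2"
      then have "M = 1" using M1 by simp
      then show False using tt t Sm by simp
    qed
    define k where "k = N - 1 - Suc m"
    have k: "N - 1 - m = Suc k" using Sm by (simp add: k_def)
    have "2 / real M \<le> 2 / (real M - 1)" using M2 by (intro divide_left_mono) auto
    then show ?thesis using M2
      unfolding rate_def S k_def[symmetric] M_def[symmetric] m_def[symmetric] k
      by (simp add: of_nat_diff algebra_simps add_divide_distrib)
  qed
qed

lemma rate_antimono:
  assumes "0 < N" "2 * N - 1 \<le> s" "s \<le> t"
  shows "rate N t \<le> rate N s"
  using assms(3)
proof (induction t rule: dec_induct)
  case (step n)
  then show ?case using rate_Suc_le[of N n] assms(1,2) by linarith
qed simp

lemma rate_pos: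
  assumes N: "2 \<le> N" and t: "2 * N - 1 \<le> t"
  shows "0 < rate N t"
proof (cases "t div N \<le> 1")
  case True
  have "1 \<le> t div N" using t N by (simp add: less_eq_div_iff_mult_less_eq)
  then show ?thesis using True by (simp add: rate_def add_nonneg_pos)
next
  case False
  then have M: "0 < real (t div N)" "0 < real (t div N - 1)" by auto
  consider "0 < t mod N" | "0 < N - 1 - t mod N"
    using N by linarith
  then show ?thesis
  proof cases
    case 1
    then have "0 < 2 * real (t mod N) / real (t div N)" using M by simp
    then show ?thesis unfolding rate_def by (intro add_pos_nonneg) auto
  next
    case 2
    then have "0 < 2 * real (N - 1 - t mod N) / real (t div N - 1)" using M by simp
    then show ?thesis unfolding rate_def by (intro add_pos_nonneg add_nonneg_pos) auto
  qed
qed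

text \<open>
  The order of the axes fixes the cyclic order in which the boxes grow. As \<open>'n\<close> has
  no order of its own, an enumeration of it is a parameter.
\<close>

locale ordered_axes =
  fixes idx :: "'n::finite \<Rightarrow> nat"
  assumes bij_idx: "bij_betw idx UNIV {..<CARD('n)}"
begin

lemma idx_less: "idx i < CARD('n)"
  using bij_idx by (auto simp: bij_betw_def)

lemma idx_eq_iff: "idx i = idx j \<longleftrightarrow> i = j"
  using bij_idx by (auto simp: bij_betw_def inj_on_def)

definition weight :: "int ^ 'n \<Rightarrow> 'n \<Rightarrow> nat" where
  "weight x i = CARD('n) * layer (x $ i) + idx i"

text \<open>
  The time at which the growing box reaches \<open>x\<close>. Coordinate \<open>i\<close> of the box gets its \<open>k\<close>-th
  point at time \<open>N * k + idx i\<close>, and \<open>x\<close> belongs to the box as soon as all its coordinates do.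
  Weights of different axes differ, so the maximum is attained for exactly one axis:
  the normal of the slab that contains \<open>x\<close>.
\<close>

definition time :: "int ^ 'n \<Rightarrow> nat" where
  "time x = Max (range (weight x))"

text \<open>
  The side length in direction \<open>i\<close> of the box at time \<open>t\<close>.
\<close>

definition side :: "nat \<Rightarrow> 'n \<Rightarrow> nat" where
  "side t i = (t - idx i) div CARD('n)"

lemma weight_div: "weight x i div CARD('n) = layer (x $ i)"
  and weight_mod: "weight x i mod CARD('n) = idx i"
  using idx_less[of i] by (auto simp: weight_def)

lemma weight_eq_iff: "weight x i = weight x j \<longleftrightarrow> i = j"
  by (metis weight_mod idx_eq_iff)

lemma weight_le_iff_layer: "weight x i \<le> t \<longleftrightarrow> layer (x $ i) \<le> side t i"
proof -
  have "0 < CARD('n) * layer (x $ i)" using layer_ge_1[of "x $ i"] by simp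
  then have "weight x i \<le> t \<longleftrightarrow> layer (x $ i) * CARD('n) \<le> t - idx i"
    unfolding weight_def mult.commute[of "layer (x $ i)"] by linarith
  then show ?thesis by (simp add: side_def less_eq_div_iff_mult_less_eq)
qed

lemma weight_le_time: "weight x i \<le> time x"
  by (simp add: time_def)

lemma time_le_iff: "time x \<le> t \<longleftrightarrow> (\<forall>i. weight x i \<le> t)"
  by (simp add: time_def)

lemma time_less_iff: "time x < t \<longleftrightarrow> (\<forall>i. weight x i < t)"
  by (simp add: time_def)

lemma time_attained: obtains d where "weight x d = time x"
proof -
  have "time x \<in> range (weight x)" unfolding time_def by (rule Max_in) auto
  then show ?thesis using that by auto
qed

text \<open>
  The sign is that of the family in the set-valued Laplacian: minus the unit flow that
  runs from earlier to later points. In the last case \<open>x\<close> and \<open>y\<close> lie in the same slab; for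
  neighbours only the summand of the axis that joins them is nonzero.
\<close>

definition flow :: "int ^ 'n \<Rightarrow> int ^ 'n \<Rightarrow> real" where
  "flow x y = (if time x < time y then - 1 else if time y < time x then 1
     else - (\<Sum>i\<in>UNIV. slab_flow (side (time x) i) (x $ i) (y $ i)))"

lemma flow_skew: "flow x y = - flow y x"
proof -
  have "(\<Sum>i\<in>UNIV. slab_flow (side t i) (x $ i) (y $ i)) = - (\<Sum>i\<in>UNIV. slab_flow (side t i) (y $ i) (x $ i))" for t
    by (subst slab_flow_skew) (simp add: sum_negf)
  then show ?thesis by (auto simp: flow_def)
qed

lemma slab_flow_axis_sum:
  assumes "\<And>j. j \<noteq> i \<Longrightarrow> y $ j = x $ j"
  shows "(\<Sum>j\<in>UNIV. slab_flow (a j) (x $ j) (y $ j)) = slab_flow (a i) (x $ i) (y $ i)"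
  using assms by (subst sum.remove[of _ i]) (auto intro!: sum.neutral simp: slab_flow_refl)

text \<open>
  An edge parallel to the slab of \<open>x\<close> either stays in the slab or leaves the
  box. The interpolated flow has the value \<open>1\<close> on the edges that leave, so one formula covers both.
\<close>

lemma flow_transverse:
  assumes i: "weight x i \<noteq> time x"
    and y: "\<And>j. j \<noteq> i \<Longrightarrow> y $ j = x $ j" "\<bar>y $ i - x $ i\<bar> = 1"
  shows "flow x y = - slab_flow (side (time x) i) (x $ i) (y $ i)"
proof -
  obtain d where d: "weight x d = time x" by (rule time_attained)
  have w: "weight y j = weight x j" if "j \<noteq> i" for j
    using that y(1) by (simp add: weight_def)
  have ge: "time x \<le> time y"
    using d i w weight_le_time[of y d] by metis
  show ?thesis
  proof (cases "weight y i \<le> time x")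
    case True
    then have "time y \<le> time x"
      unfolding time_le_iff using w weight_le_time by metis
    then show ?thesis using ge slab_flow_axis_sum[OF y(1)] by (simp add: flow_def)
  next
    case False
    then have "time x < time y" using weight_le_time[of y i] by linarith
    moreover have "slab_flow (side (time x) i) (x $ i) (y $ i) = 1"
      using False weight_le_time[of x i] y(2)
      by (intro slab_flow_exit) (auto simp: weight_le_iff_layer)
    ultimately show ?thesis by (simp add: flow_def)
  qed
qed

lemma flow_inward:
  assumes d: "weight x d = time x"
    and y: "\<And>j. j \<noteq> d \<Longrightarrow> y $ j = x $ j" "layer (y $ d) < layer (x $ d)"
  shows "flow x y = 1"
proof -
  have "weight y j < time x" for j
  proof (cases "j = d")
    case True
    then show ?thesis using y(2) by (simp flip: d) (simp add: weight_def)
  next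
    case False
    then have "weight y j = weight x j" using y(1) by (simp add: weight_def)
    then show ?thesis using weight_le_time[of x j] weight_eq_iff[of x j d] False d by auto
  qed
  then have "time y < time x" by (simp add: time_less_iff)
  then show ?thesis by (simp add: flow_def)
qed

lemma flow_outward:
  assumes d: "weight x d = time x" and y: "layer (x $ d) < layer (y $ d)"
  shows "flow x y = - 1"
proof -
  have "time x < weight y d" using y by (simp flip: d) (simp add: weight_def)
  also have "\<dots> \<le> time y" by (rule weight_le_time)
  finally show ?thesis by (simp add: flow_def)
qed

lemma time_ge: "2 * CARD('n) - 1 \<le> time x"
proof -
  have "CARD('n) - 1 \<in> idx ` UNIV"
    using bij_idx by (auto simp: bij_betw_def)
  then obtain i where i: "idx i = CARD('n) - 1" by auto
  have "CARD('n) * 1 \<le> CARD('n) * layer (x $ i)"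
    using layer_ge_1[of "x $ i"] by (intro mult_left_mono) auto
  then have "2 * CARD('n) - 1 \<le> weight x i"
    using i unfolding weight_def by linarith
  also have "\<dots> \<le> time x" by (rule weight_le_time)
  finally show ?thesis .
qed

text \<open>
  Relates the closed form of the rate to the geometry: at the arrival of the slab
  with normal \<open>d\<close>, the axes before \<open>d\<close> have already been extended in the present cycle.
\<close>

lemma side_sum:
  assumes t: "2 * CARD('n) - 1 \<le> t" and d: "idx d = t mod CARD('n)"
  shows "(\<Sum>i\<in>UNIV - {d}. 2 / real (side t i)) = rate CARD('n) t - (if t div CARD('n) = 1 then 2 else 0)"
proof -
  let ?N = "CARD('n)"
  let ?M = "t div ?N" and ?m = "t mod ?N"
  have tt: "t = ?M * ?N + ?m" by simp
  have side: "side t i = (if idx i \<le> ?m then ?M else ?M - 1)" for i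
  proof (cases "idx i \<le> ?m")
    case True
    then have "t - idx i = ?M * ?N + (?m - idx i)" using tt by linarith
    moreover have "?m - idx i < ?N" using mod_less_divisor[of ?N t] by (simp add: less_imp_diff_less)
    ultimately have "(t - idx i) div ?N = ?M" by simp
    then show ?thesis using True by (simp add: side_def)
  next
    case False
    have "?M > 0"
      using t by (simp add: div_greater_zero_iff)
    then obtain K where K: "?M = Suc K" by (cases ?M) auto
    then have "t = K * ?N + (?N + ?m)" using tt by simp
    then have "t - idx i = K * ?N + (?N + ?m - idx i)" using idx_less[of i] by linarith
    moreover have "?N + ?m - idx i < ?N" using False idx_less[of i] by linarith
    ultimately have "(t - idx i) div ?N = K" by simp
    then show ?thesis using False K by (simp add: side_def)
  qed
  have "bij_betw idx (UNIV - {d}) ({..<?N} - {?m})"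
    unfolding d[symmetric]
    using bij_idx by (auto simp: bij_betw_def inj_on_def)
  then have "(\<Sum>i\<in>UNIV - {d}. 2 / real (side t i))
      = (\<Sum>k\<in>{..<?N} - {?m}. 2 / real (if k \<le> ?m then ?M else ?M - 1))"
    unfolding side by (rule sum.reindex_bij_betw)
  also have "{..<?N} - {?m} = {..<?m} \<union> {?m<..<?N}"
    using mod_less_divisor[of ?N t] by (auto simp del: mod_less_divisor)
  also have "(\<Sum>k\<in>\<dots>. 2 / real (if k \<le> ?m then ?M else ?M - 1)) =
     (\<Sum>k\<in>{..<?m}. 2 / real ?M) + (\<Sum>k\<in>{?m<..<?N}. 2 / real (?M - 1))"
    by (subst sum.union_disjoint) (auto intro!: arg_cong2[where f = "(+)"] sum.cong)
  finally show ?thesis by (simp add: rate_def mult.commute)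
qed

text \<open>
  A parallel direction contributes \<open>2 / a\<close>. In the normal direction the flow comes
  from the earlier neighbour and goes on to the later one, so its contribution
  cancels, except at the origin, both of whose neighbours in that direction are later.
\<close>

lemma flow_divergence: "(\<Sum>y | x \<sim>\<^sub>Z y. flow x y) = - rate CARD('n) (time x)"
proof -
  obtain d where d: "weight x d = time x" by (rule time_attained)
  have M: "layer (x $ d) = time x div CARD('n)" and m: "idx d = time x mod CARD('n)"
    using weight_div[of x d] weight_mod[of x d] d by auto
  let ?g = "\<lambda>i. flow x (x + axis i 1) + flow x (x - axis i 1)"
  have tr: "?g i = - (2 / real (side (time x) i))" if "i \<noteq> d" for i
  proof -
    have i: "weight x i \<noteq> time x" using that d weight_eq_iff by metis
    have "flow x (x + axis i 1) = - slab_flow (side (time x) i) (x $ i) (x $ i + 1)"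
      by (subst flow_transverse[OF i]) (auto simp: axis_def)
    moreover have "flow x (x - axis i 1) = - slab_flow (side (time x) i) (x $ i) (x $ i - 1)"
      by (subst flow_transverse[OF i]) (auto simp: axis_def)
    ultimately show ?thesis using slab_flow_divergence[of "side (time x) i" "x $ i"] by linarith
  qed
  have al: "?g d = - (if time x div CARD('n) = 1 then 2 else 0)"
  proof (cases "layer (x $ d) = 1")
    case True
    then have "x $ d = 0" by (simp add: layer_eq_1_iff)
    then have "flow x (x + axis d 1) = - 1" "flow x (x - axis d 1) = - 1"
      by (intro flow_outward[OF d]; simp add: axis_def layer_def)+
    then show ?thesis using True M by simp
  next
    case False
    from layer_step[OF False] have "?g d = 0"
    proof
      assume "layer (x $ d + 1) < layer (x $ d) \<and> layer (x $ d) < layer (x $ d - 1)"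
      then have "flow x (x + axis d 1) = 1" "flow x (x - axis d 1) = - 1"
        by (intro flow_inward[OF d] flow_outward[OF d]; simp add: axis_def)+
      then show ?thesis by simp
    next
      assume "layer (x $ d - 1) < layer (x $ d) \<and> layer (x $ d) < layer (x $ d + 1)"
      then have "flow x (x - axis d 1) = 1" "flow x (x + axis d 1) = - 1"
        by (intro flow_inward[OF d] flow_outward[OF d]; simp add: axis_def)+
      then show ?thesis by simp
    qed
    then show ?thesis using False M by simp
  qed
  have "(\<Sum>y | x \<sim>\<^sub>Z y. flow x y) = ?g d + (\<Sum>i\<in>UNIV - {d}. ?g i)"
    unfolding sum_neighbours by (subst sum.remove[of _ d]) auto
  also have "(\<Sum>i\<in>UNIV - {d}. ?g i) = - (\<Sum>i\<in>UNIV - {d}. 2 / real (side (time x) i))"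
    unfolding sum_negf[symmetric] by (intro sum.cong) (auto simp: tr)
  also have "\<dots> = - rate CARD('n) (time x) + (if time x div CARD('n) = 1 then 2 else 0)"
    using side_sum[OF time_ge m] by simp
  finally show ?thesis using al by simp
qed

lemma flow_bound:
  assumes "x \<sim>\<^sub>Z y" "time x = time y"
  shows "\<bar>flow x y\<bar> \<le> 1"
proof -
  from assms(1) obtain i where "y = x + axis i 1 \<or> y = x - axis i 1"
    by (auto simp: adj_iff_axis)
  then have y: "\<And>j. j \<noteq> i \<Longrightarrow> y $ j = x $ j" "\<bar>y $ i - x $ i\<bar> = 1"
    by (auto simp: axis_def)
  have "\<bar>slab_flow (side (time x) i) (x $ i) (y $ i)\<bar> \<le> 1"
    using weight_le_time[of x i] weight_le_time[of y i] assms(2) y(2)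
    by (intro slab_flow_inside) (auto simp: weight_le_iff_layer)
  then show ?thesis
    using assms(2) slab_flow_axis_sum[OF y(1)] by (simp add: flow_def)
qed

lemma one_laplacian_solution:
  assumes N: "2 \<le> CARD('n)" and r: "r > 0"
  defines "u \<equiv> \<lambda>x. rate CARD('n) (time x) powr (1 / r)"
  shows "u x > 0" and "sign_family u flow"
    and "(\<Sum>y | x \<sim>\<^sub>Z y. flow x y) + u x powr r = 0"
proof -
  have pos: "0 < rate CARD('n) (time x)" for x by (rule rate_pos[OF N time_ge])
  then show "u x > 0" by (metis u_def powr_gt_zero less_irrefl)
  have mono: "u y \<le> u x" if "time x \<le> time y" for x y
    unfolding u_def using that pos[of y] r
    by (intro powr_mono2 rate_antimono time_ge) (auto simp: less_imp_le)
  show "sign_family u flow" unfolding sign_family_def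
  proof (intro allI impI conjI)
    fix x y :: "int ^ 'n" assume xy: "x \<sim>\<^sub>Z y"
    show "flow x y = - flow y x" by (rule flow_skew)
    consider "time x < time y" | "time y < time x" | "time x = time y" by linarith
    then show "flow x y \<in> sign_set (u y - u x)"
    proof cases
      case 1 then show ?thesis using mono[of x y] by (simp add: flow_def sign_set_def)
    next
      case 2 then show ?thesis using mono[of y x] by (simp add: flow_def sign_set_def)
    next
      case 3 then show ?thesis using flow_bound[OF xy]
        by (simp add: u_def sign_set_def abs_le_iff)
    qed
  qed
  have "u x powr r = rate CARD('n) (time x)" using pos[of x] r by (simp add: u_def powr_powr)
  then show "(\<Sum>y | x \<sim>\<^sub>Z y. flow x y) + u x powr r = 0"
    by (simp add: flow_divergence)
qed

end

section \<open>Finitely supported functions and their energy\<close>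

lemma infsum_finite_support:
  fixes f :: "'a \<Rightarrow> real"
  assumes "finite F" "\<And>x. x \<notin> F \<Longrightarrow> f x = 0"
  shows "(\<Sum>\<^sub>\<infinity>x. f x) = sum f F"
proof -
  have "(\<Sum>\<^sub>\<infinity>x. f x) = infsum f F"
    using assms(2) by (intro infsum_cong_neutral) auto
  then show ?thesis using assms(1) by simp
qed

text \<open>
  Convexity of the power, weighted so that a path of \<open>k\<close> steps followed by one more step
  loses nothing: with \<open>s = k\<close> and \<open>t = 1\<close> it turns a bound \<open>k powr p\<close> into \<open>(k + 1) powr p\<close>.
\<close>

lemma powr_add_le:
  fixes a b s t p :: real
  assumes "1 \<le> p" "0 \<le> a" "0 \<le> b" "0 < s" "0 < t"
  shows "(a + b) powr p \<le> (s + t) powr (p - 1) * (a powr p / s powr (p - 1) + b powr p / t powr (p - 1))"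
proof -
  have mono: "1 \<le> (s + t) powr (p - 1) / s powr (p - 1)" "1 \<le> (s + t) powr (p - 1) / t powr (p - 1)"
    using assms by (simp_all add: powr_mono2)
  show ?thesis
  proof (cases "a = 0 \<or> b = 0")
    case True
    then show ?thesis
      using mult_right_mono[OF mono(1), of "a powr p"] mult_right_mono[OF mono(2), of "b powr p"] assms
      by auto
  next
    case False
    then have ab: "0 < a" "0 < b" using assms by auto
    define c where "c = s + t"
    have c: "0 < c" using assms by (simp add: c_def)
    have frac: "1 - t / c = s / c" using assms by (simp add: c_def field_simps)
    have "((1 - t / c) *\<^sub>R (a * c / s) + (t / c) *\<^sub>R (b * c / t)) powr p
       \<le> (1 - t / c) * (a * c / s) powr p + (t / c) * (b * c / t) powr p"
      using convex_onD[OF powr_convex[OF assms(1)], of "t / c" "a * c / s" "b * c / t"] ab assms c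
      by (simp add: c_def)
    moreover have "(1 - t / c) *\<^sub>R (a * c / s) + (t / c) *\<^sub>R (b * c / t) = a + b"
      unfolding frac using assms c by simp
    moreover have scale: "(r / c) * (e * c / r) powr p = c powr (p - 1) * (e powr p / r powr (p - 1))"
      if "0 < r" "0 < e" for r e
      using that c by (simp add: powr_mult powr_divide powr_diff)
    have "(1 - t / c) * (a * c / s) powr p = c powr (p - 1) * (a powr p / s powr (p - 1))"
      unfolding frac using scale assms ab by simp
    moreover have "(t / c) * (b * c / t) powr p = c powr (p - 1) * (b powr p / t powr (p - 1))"
      using scale assms ab by simp
    ultimately show ?thesis by (simp add: c_def distrib_left)
  qed
qed

definition finsupp :: "('a \<Rightarrow> real) \<Rightarrow> bool" where
  "finsupp u \<longleftrightarrow> finite {x. u x \<noteq> 0}"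

definition increment_energy :: "real \<Rightarrow> 'a::ab_group_add \<Rightarrow> ('a \<Rightarrow> real) \<Rightarrow> real" where
  "increment_energy p z u = (\<Sum>\<^sub>\<infinity>x. \<bar>u (x + z) - u x\<bar> powr p)"

definition energy :: "real \<Rightarrow> (int ^ 'n::finite \<Rightarrow> real) \<Rightarrow> real" where
  "energy p u = (\<Sum>i\<in>UNIV. increment_energy p (axis i 1) u)"

lemma finsupp_shift:
  fixes u :: "'a::ab_group_add \<Rightarrow> real"
  assumes "finsupp u"
  shows "finsupp (\<lambda>x. u (x + z))"
proof -
  have "{x. u (x + z) \<noteq> 0} = (\<lambda>x. x - z) ` {x. u x \<noteq> 0}"
    by (auto simp: image_iff) (metis add_diff_cancel)
  then show ?thesis using assms by (simp add: finsupp_def)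
qed

lemma finsupp_compose2:
  assumes "finsupp u" "finsupp v" "h 0 0 = 0"
  shows "finsupp (\<lambda>x. h (u x) (v x))"
  unfolding finsupp_def
  by (rule finite_subset[of _ "{x. u x \<noteq> 0} \<union> {x. v x \<noteq> 0}"])
     (use assms in \<open>auto simp: finsupp_def\<close>)

lemma finsupp_compose:
  assumes "finsupp u" "h 0 = 0"
  shows "finsupp (\<lambda>x. h (u x))"
  using finsupp_compose2[OF assms(1,1), of "\<lambda>a b. h a"] assms(2) by simp

lemma finsupp_increment:
  fixes u :: "'a::ab_group_add \<Rightarrow> real"
  assumes "finsupp u"
  shows "finsupp (\<lambda>x. \<bar>u (x + z) - u x\<bar> powr p)"
  by (rule finsupp_compose2[OF finsupp_shift[OF assms] assms, of "\<lambda>a b. \<bar>a - b\<bar> powr p"]) simp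

lemma finsupp_summable: "finsupp u \<Longrightarrow> u summable_on A"
  unfolding finsupp_def
  by (rule finite_nonzero_values_imp_summable_on) (auto elim: rev_finite_subset)

lemma infsum_shift:
  fixes f :: "'a::ab_group_add \<Rightarrow> real"
  shows "(\<Sum>\<^sub>\<infinity>x. f (x + z)) = (\<Sum>\<^sub>\<infinity>x. f x)"
  by (rule infsum_reindex_bij_betw) (rule bij_betwI[of _ _ _ "\<lambda>x. x - z"], auto)

lemma increment_energy_nonneg: "0 \<le> increment_energy p z u"
  by (simp add: increment_energy_def infsum_nonneg)

lemma increment_energy_le_energy: "increment_energy p (axis i 1) u \<le> energy p u"
  unfolding energy_def by (rule member_le_sum) (auto simp: increment_energy_nonneg)

lemma energy_nonneg: "0 \<le> energy p u"
  unfolding energy_def by (simp add: sum_nonneg increment_energy_nonneg)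

lemma increment_energy_minus: "increment_energy p (- z) u = increment_energy p z u"
  unfolding increment_energy_def
  by (subst infsum_shift[of _ z, symmetric]) (simp add: abs_minus_commute)

lemma increment_energy_mono:
  assumes "finsupp u" "finsupp v" "0 \<le> p" "\<And>x y. \<bar>v x - v y\<bar> \<le> \<bar>u x - u y\<bar>"
  shows "increment_energy p z v \<le> increment_energy p z u"
  unfolding increment_energy_def
  by (intro infsum_mono finsupp_summable finsupp_increment assms powr_mono2) auto

lemma energy_mono:
  assumes "finsupp u" "finsupp v" "0 \<le> p" "\<And>x y. \<bar>v x - v y\<bar> \<le> \<bar>u x - u y\<bar>"
  shows "energy p v \<le> energy p u"
  unfolding energy_def by (intro sum_mono increment_energy_mono assms)

lemma energy_shift: "energy p (\<lambda>x. u (x + a)) = energy p u"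
proof -
  have "increment_energy p z (\<lambda>x. u (x + a)) = increment_energy p z u" for z
    unfolding increment_energy_def
    using infsum_shift[of "\<lambda>x. \<bar>u (x + z) - u x\<bar> powr p" a] by (simp add: add_ac)
  then show ?thesis by (simp add: energy_def)
qed

lemma energy_scale:
  assumes "0 \<le> c"
  shows "energy p (\<lambda>x. c * u x) = c powr p * energy p u"
proof -
  have "\<bar>c * u (x + z) - c * u x\<bar> powr p = c powr p * \<bar>u (x + z) - u x\<bar> powr p" for x z
    using assms by (simp add: powr_mult abs_mult flip: right_diff_distrib)
  then show ?thesis
    by (simp add: energy_def increment_energy_def infsum_cmult_right' sum_distrib_left)
qed

text \<open>
  A translation by \<open>z\<close> is a path of unit steps, each of which costs at most the energy.
  The induction on the length of the path replaces Minkowski's inequality.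
\<close>

lemma increment_energy_le:
  fixes u :: "int ^ 'n::finite \<Rightarrow> real"
  assumes u: "finsupp u" and p: "1 \<le> p"
  shows "increment_energy p z u \<le> real_of_int (\<Sum>k\<in>UNIV. \<bar>z $ k\<bar>) powr p * energy p u"
proof (induction "nat (\<Sum>k\<in>UNIV. \<bar>z $ k\<bar>)" arbitrary: z)
  case 0
  have "(\<Sum>k\<in>UNIV. \<bar>z $ k\<bar>) \<ge> 0" by (simp add: sum_nonneg)
  with 0 have s0: "(\<Sum>k\<in>UNIV. \<bar>z $ k\<bar>) = 0" by simp
  then have "z = 0" by (subst (asm) sum_nonneg_eq_0_iff) (auto simp: vec_eq_iff)
  then show ?case by (simp add: increment_energy_def)
next
  case (Suc k)
  then have "z \<noteq> 0" by auto
  then obtain z' i where z: "z = z' + axis i 1 \<or> z = z' - axis i 1"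
    and norm: "(\<Sum>k\<in>UNIV. \<bar>z $ k\<bar>) = (\<Sum>k\<in>UNIV. \<bar>z' $ k\<bar>) + 1"
    by (rule closer_to_origin)
  have nn: "(\<Sum>k\<in>UNIV. \<bar>z' $ k\<bar>) \<ge> 0" by (simp add: sum_nonneg)
  with norm Suc(2) have k: "k = nat (\<Sum>k\<in>UNIV. \<bar>z' $ k\<bar>)" by simp
  have kk: "(\<Sum>k\<in>UNIV. \<bar>z' $ k\<bar>) = int k" "(\<Sum>k\<in>UNIV. \<bar>z $ k\<bar>) = int k + 1" using k nn norm by auto
  define e where "e = z - z'"
  have e: "increment_energy p e u \<le> energy p u"
    using z increment_energy_le_energy[of p i u] increment_energy_minus[of p "axis i 1" u]
    by (auto simp: e_def)
  have IH: "increment_energy p z' u \<le> real k powr p * energy p u"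
    using Suc(1)[OF k] kk by simp
  \<comment> \<open>The first step is separate because the convexity inequality needs positive weights.\<close>
  show ?case
  proof (cases "k = 0")
    case True
    then have "\<forall>j. z' $ j = 0" using kk(1) sum_nonneg_eq_0_iff[of UNIV "\<lambda>j. \<bar>z' $ j\<bar>"] by simp
    then have "e = z" by (auto simp: e_def vec_eq_iff)
    then show ?thesis using e True kk by simp
  next
    case False
    then have k0: "0 < real k" by simp
    let ?c = "(real k + 1) powr (p - 1)"
    have "increment_energy p z u \<le> (\<Sum>\<^sub>\<infinity>x. ?c * (\<bar>u (x + z') - u x\<bar> powr p / real k powr (p - 1)
            + \<bar>u (x + z' + e) - u (x + z')\<bar> powr p))"
      unfolding increment_energy_def
    proof (intro infsum_mono finsupp_summable)
      show "finsupp (\<lambda>x. \<bar>u (x + z) - u x\<bar> powr p)" using u by (rule finsupp_increment)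
      show "finsupp (\<lambda>x. ?c * (\<bar>u (x + z') - u x\<bar> powr p / real k powr (p - 1)
            + \<bar>u (x + z' + e) - u (x + z')\<bar> powr p))"
        by (rule finsupp_compose2[OF finsupp_increment[OF u] finsupp_shift[OF finsupp_increment[OF u]],
              of "\<lambda>a b. ?c * (a / real k powr (p - 1) + b)"]) simp
      fix x
      have "\<bar>u (x + z) - u x\<bar> powr p \<le> (\<bar>u (x + z') - u x\<bar> + \<bar>u (x + z' + e) - u (x + z')\<bar>) powr p"
        using p by (intro powr_mono2) (auto simp: e_def)
      also have "\<dots> \<le> ?c * (\<bar>u (x + z') - u x\<bar> powr p / real k powr (p - 1)
            + \<bar>u (x + z' + e) - u (x + z')\<bar> powr p / 1 powr (p - 1))"
        using p k0 by (intro powr_add_le) auto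
      finally show "\<bar>u (x + z) - u x\<bar> powr p \<le> ?c * (\<bar>u (x + z') - u x\<bar> powr p / real k powr (p - 1)
            + \<bar>u (x + z' + e) - u (x + z')\<bar> powr p)" by simp
    qed
    also have "\<dots> = ?c * ((\<Sum>\<^sub>\<infinity>x. \<bar>u (x + z') - u x\<bar> powr p / real k powr (p - 1))
        + (\<Sum>\<^sub>\<infinity>x. \<bar>u (x + z' + e) - u (x + z')\<bar> powr p))"
    proof (subst infsum_cmult_right', subst infsum_add)
      show "(\<lambda>x. \<bar>u (x + z') - u x\<bar> powr p / real k powr (p - 1)) summable_on UNIV"
        by (rule finsupp_summable[OF finsupp_compose[OF finsupp_increment[OF u], of "\<lambda>a. a / real k powr (p - 1)"]]) simp
      show "(\<lambda>x. \<bar>u (x + z' + e) - u (x + z')\<bar> powr p) summable_on UNIV"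
        by (rule finsupp_summable[OF finsupp_shift[OF finsupp_increment[OF u]]])
    qed simp
    also have "(\<Sum>\<^sub>\<infinity>x. \<bar>u (x + z' + e) - u (x + z')\<bar> powr p) = increment_energy p e u"
      unfolding increment_energy_def by (rule infsum_shift[of "\<lambda>x. \<bar>u (x + e) - u x\<bar> powr p"])
    also have "(\<Sum>\<^sub>\<infinity>x. \<bar>u (x + z') - u x\<bar> powr p / real k powr (p - 1))
        = increment_energy p z' u / real k powr (p - 1)"
      unfolding increment_energy_def divide_inverse by (rule infsum_cmult_left')
    also have "?c * (increment_energy p z' u / real k powr (p - 1) + increment_energy p e u)
        \<le> ?c * (real k powr p * energy p u / real k powr (p - 1) + energy p u)"
      using IH e by (intro mult_left_mono add_mono divide_right_mono) auto
    also have "\<dots> = ?c * (real k + 1) * energy p u"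
      using k0 by (simp add: powr_diff algebra_simps)
    also have "?c * (real k + 1) = (real k + 1) powr p"
      using powr_add[of "real k + 1" "p - 1" 1] by simp
    finally show ?thesis using kk by simp
  qed
qed

section \<open>A Sobolev inequality from level sets\<close>

lemma card_box:
  fixes r :: nat
  shows "finite {z :: int ^ 'n::finite. \<forall>i. 0 \<le> z $ i \<and> z $ i < int r}"
    and "card {z :: int ^ 'n::finite. \<forall>i. 0 \<le> z $ i \<and> z $ i < int r} = r ^ CARD('n)"
proof -
  let ?F = "PiE (UNIV :: 'n set) (\<lambda>_. {0..<int r})"
  have "{z :: int ^ 'n. \<forall>i. 0 \<le> z $ i \<and> z $ i < int r} = vec_lambda ` ?F"
  proof (intro equalityI subsetI)
    fix z :: "int ^ 'n" assume "z \<in> {z. \<forall>i. 0 \<le> z $ i \<and> z $ i < int r}"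
    then have "vec_nth z \<in> ?F" by auto
    then show "z \<in> vec_lambda ` ?F" by (metis image_eqI vec_nth_inverse)
  qed (auto simp: PiE_def Pi_def)
  moreover have "inj_on vec_lambda ?F" by (auto simp: inj_on_def vec_lambda_inject)
  ultimately show "finite {z :: int ^ 'n. \<forall>i. 0 \<le> z $ i \<and> z $ i < int r}"
    "card {z :: int ^ 'n. \<forall>i. 0 \<le> z $ i \<and> z $ i < int r} = r ^ CARD('n)"
    by (auto simp: card_image card_PiE intro!: finite_imageI finite_PiE)
qed

text \<open>
  Truncate \<open>u\<close> between \<open>c\<close> and \<open>2 * c\<close>; this does not increase the energy. Take a cube of
  translations with at least twice as many points as \<open>{u > c}\<close>. From a point of
  \<open>{u > 2 * c}\<close>, at least half of them leave \<open>{u > c}\<close>, and then the truncation drops by \<open>c\<close>.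
  Summing over the points and the translations, and bounding the energy of each translation
  in terms of the side length of the cube, compares the sizes of the two level sets.
\<close>

lemma level_set_estimate:
  fixes u :: "int ^ 'n::finite \<Rightarrow> real"
  assumes u: "finsupp u" and p: "1 \<le> p" and c: "0 < c"
  defines "N \<equiv> real CARD('n)"
  shows "real (card {x. 2 * c < u x})
    \<le> 2 * (4 * N / c) powr p * real (card {x. c < u x}) powr (p / N) * energy p u"
proof -
  define A where "A = {x. 2 * c < u x}"
  define B where "B = {x. c < u x}"
  have fin: "finite A" "finite B"
    using u c unfolding A_def B_def finsupp_def by (auto elim!: rev_finite_subset)
  have AB: "A \<subseteq> B" using c by (auto simp: A_def B_def)
  have N1: "N \<ge> 1" by (simp add: N_def)
  show ?thesis
  proof (cases "B = {}")
    case True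
    then have "A = {}" using AB by auto
    then show ?thesis unfolding A_def[symmetric] by (simp add: energy_nonneg)
  next
    case False
    define b where "b = real (card B)"
    have b: "b \<ge> 1" using False fin by (simp add: b_def Suc_le_eq card_gt_0_iff)
    \<comment> \<open>The side length of the cube: just large enough that the cube has at least \<open>2 * b\<close> points.\<close>
    define r where "r = nat \<lceil>(2 * b) powr (1 / N)\<rceil>"
    have root1: "(2 * b) powr (1 / N) \<ge> 1" using b N1 by (simp add: ge_one_powr_ge_zero)
    have r_ge: "(2 * b) powr (1 / N) \<le> real r" unfolding r_def by linarith
    have "real r \<le> (2 * b) powr (1 / N) + 1" unfolding r_def using root1 by linarith
    also have "\<dots> \<le> 2 * (2 * b) powr (1 / N)" using root1 by simp
    also have "\<dots> = 2 * 2 powr (1 / N) * b powr (1 / N)" using b by (simp add: powr_mult)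
    also have "\<dots> \<le> 2 * 2 powr 1 * b powr (1 / N)"
      using N1 b by (intro mult_right_mono mult_left_mono powr_mono) auto
    finally have r_le: "real r \<le> 4 * b powr (1 / N)" by simp
    have r0: "real r > 0" using r_ge root1 by linarith
    have "2 * b = ((2 * b) powr (1 / N)) powr N" using b N1 by (simp add: powr_powr)
    also have "\<dots> \<le> real r powr N" using r_ge N1 root1 by (intro powr_mono2) auto
    also have "\<dots> = real (r ^ CARD('n))" using r0 by (simp add: N_def powr_realpow)
    finally have rN: "2 * b \<le> real (r ^ CARD('n))" .
    define Q where "Q = {z :: int ^ 'n. \<forall>i. 0 \<le> z $ i \<and> z $ i < int r}"
    have finQ: "finite Q" and cardQ: "card Q = r ^ CARD('n)"
      unfolding Q_def by (rule card_box)+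
    define v where "v x = min (max (u x - c) 0) c" for x
    have v: "finsupp v"
      unfolding v_def[abs_def] using c
      by (intro finsupp_compose[OF u, of "\<lambda>a. min (max (a - c) 0) c"]) auto
    have Ev: "energy p v \<le> energy p u"
      using p by (intro energy_mono u v) (auto simp: v_def)
    have vA: "v x = c" if "x \<in> A" for x using that c by (auto simp: A_def v_def)
    have vB: "v x = 0" if "x \<notin> B" for x using that c by (auto simp: B_def v_def)
    have low: "real (card Q) / 2 * c powr p \<le> (\<Sum>z\<in>Q. \<bar>v (x + z) - v x\<bar> powr p)" if x: "x \<in> A" for x
    proof -
      define G where "G = {z \<in> Q. x + z \<in> B}"
      have "card G \<le> card B"
        by (rule card_inj_on_le[of "\<lambda>z. x + z"]) (auto simp: G_def fin)
      moreover have G: "G \<subseteq> Q" by (auto simp: G_def)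
      ultimately have "real (card Q) / 2 \<le> real (card (Q - G))"
        using rN finQ finite_subset[OF G finQ] card_mono[OF finQ G]
        by (subst card_Diff_subset) (auto simp: b_def cardQ of_nat_diff)
      then have "real (card Q) / 2 * c powr p \<le> real (card (Q - G)) * c powr p"
        by (rule mult_right_mono) simp
      also have "\<dots> = (\<Sum>z\<in>Q - G. c powr p)" by simp
      also have "(\<Sum>z\<in>Q - G. c powr p) = (\<Sum>z\<in>Q - G. \<bar>v (x + z) - v x\<bar> powr p)"
        using vA[OF x] vB c by (intro sum.cong) (auto simp: G_def)
      also have "\<dots> \<le> (\<Sum>z\<in>Q. \<bar>v (x + z) - v x\<bar> powr p)"
        by (intro sum_mono2 finQ) auto
      finally show ?thesis .
    qed
    have up: "(\<Sum>x\<in>A. \<bar>v (x + z) - v x\<bar> powr p) \<le> (N * real r) powr p * energy p u" if z: "z \<in> Q" for z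
    proof -
      have "(\<Sum>x\<in>A. \<bar>v (x + z) - v x\<bar> powr p) \<le> increment_energy p z v"
        unfolding increment_energy_def
        by (intro finite_sum_le_infsum finsupp_summable finsupp_increment v fin) auto
      also have "\<dots> \<le> real_of_int (\<Sum>k\<in>UNIV. \<bar>z $ k\<bar>) powr p * energy p v"
        by (rule increment_energy_le[OF v p])
      also have "\<dots> \<le> (N * real r) powr p * energy p u"
      proof (intro mult_mono powr_mono2 Ev)
        have "(\<Sum>k\<in>UNIV. \<bar>z $ k\<bar>) \<le> (\<Sum>k\<in>(UNIV :: 'n set). int r)"
          using z by (intro sum_mono) (auto simp: Q_def less_imp_le)
        then have "(\<Sum>k\<in>UNIV. \<bar>z $ k\<bar>) \<le> int (CARD('n) * r)" by simp
        then have "real_of_int (\<Sum>k\<in>UNIV. \<bar>z $ k\<bar>) \<le> real_of_int (int (CARD('n) * r))"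
          by (rule of_int_le_iff[THEN iffD2])
        then show "real_of_int (\<Sum>k\<in>UNIV. \<bar>z $ k\<bar>) \<le> N * real r" by (simp add: N_def)
      qed (use p in \<open>auto simp: energy_nonneg sum_nonneg\<close>)
      finally show ?thesis .
    qed
    have "real (card A) * (real (card Q) / 2 * c powr p) = (\<Sum>x\<in>A. real (card Q) / 2 * c powr p)"
      by simp
    also have "\<dots> \<le> (\<Sum>x\<in>A. \<Sum>z\<in>Q. \<bar>v (x + z) - v x\<bar> powr p)"
      by (intro sum_mono low)
    also have "\<dots> = (\<Sum>z\<in>Q. \<Sum>x\<in>A. \<bar>v (x + z) - v x\<bar> powr p)" by (rule sum.swap)
    also have "\<dots> \<le> (\<Sum>z\<in>Q. (N * real r) powr p * energy p u)"
      by (intro sum_mono up)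
    also have "\<dots> = real (card Q) * ((N * real r) powr p * energy p u)" by simp
    finally have "real (card Q) * (real (card A) * c powr p) \<le> real (card Q) * (2 * (N * real r) powr p * energy p u)"
      by (simp add: algebra_simps)
    moreover have "0 < real (card Q)" using r0 by (simp add: cardQ)
    ultimately have "real (card A) * c powr p \<le> 2 * (N * real r) powr p * energy p u"
      by (rule mult_left_le_imp_le)
    also have "\<dots> \<le> 2 * ((4 * N) powr p * b powr (p / N)) * energy p u"
    proof (intro mult_right_mono mult_left_mono energy_nonneg)
      have "(N * real r) powr p \<le> (N * (4 * b powr (1 / N))) powr p"
        using p N1 r_le by (intro powr_mono2 mult_left_mono) auto
      also have "\<dots> = (4 * N) powr p * b powr (p / N)"
        using N1 b by (simp add: powr_mult powr_powr)
      finally show "(N * real r) powr p \<le> (4 * N) powr p * b powr (p / N)" .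
    qed simp
    finally have "real (card A) * c powr p \<le> 2 * ((4 * N) powr p * b powr (p / N)) * energy p u" .
    then have "real (card A) \<le> 2 * ((4 * N) powr p * b powr (p / N)) * energy p u / c powr p"
      using c by (simp add: pos_le_divide_eq)
    then show ?thesis using c N1
      by (simp add: A_def B_def b_def powr_divide)
  qed
qed

text \<open>
  The exponent \<open>s\<close> is the fixed point of \<open>s = p + \<theta> * s\<close>, so \<open>b k = a k / 2 powr (s * k)\<close> satisfies
  \<open>b k \<le> D' * b (k + 1) powr \<theta>\<close> with a constant independent of \<open>k\<close>. The supremum \<open>M\<close> of \<open>b\<close>,
  finite by the a priori bound \<open>A\<close>, obeys \<open>M \<le> D' * M powr \<theta>\<close> with \<open>\<theta> < 1\<close>, which bounds it
  independently of \<open>A\<close>.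
\<close>

lemma sublinear_recursion_bound:
  fixes a :: "nat \<Rightarrow> real"
  assumes nonneg: "\<And>k. 0 \<le> a k" and bdd: "\<And>k. a k \<le> A"
    and rec: "\<And>k. a k \<le> D * 2 powr (p * real k) * a (Suc k) powr \<theta>"
    and D: "0 \<le> D" and \<theta>: "0 < \<theta>" "\<theta> < 1" and s: "0 \<le> s" "p + \<theta> * s = s"
  shows "a k \<le> (D * 2 powr (\<theta> * s)) powr (1 / (1 - \<theta>)) * 2 powr (s * real k)"
proof -
  define b where "b k = a k * 2 powr (- (s * real k))" for k
  have b0: "0 \<le> b k" for k using nonneg by (simp add: b_def)
  have ab: "a k = b k * 2 powr (s * real k)" for k
    by (simp add: b_def powr_minus mult.assoc)
  have bA: "b k \<le> A" for k
  proof -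
    have "b k \<le> a k * 2 powr 0"
      unfolding b_def using nonneg s by (intro mult_left_mono powr_mono) auto
    then show ?thesis using bdd[of k] by simp
  qed
  have bd: "bdd_above (range b)" by (rule bdd_aboveI2[OF bA])
  define M where "M = (SUP k. b k)"
  have bM: "b k \<le> M" for k unfolding M_def by (rule cSUP_upper[OF _ bd]) simp
  have M0: "0 \<le> M" using b0 bM order_trans by blast
  define D' where "D' = D * 2 powr (\<theta> * s)"
  have "b k \<le> D' * M powr \<theta>" for k
  proof -
    have "b k \<le> D * 2 powr (p * real k) * a (Suc k) powr \<theta> * 2 powr (- (s * real k))"
      unfolding b_def using rec by (intro mult_right_mono) auto
    also have "\<dots> = D * b (Suc k) powr \<theta> * (2 powr (p * real k) * 2 powr (s * real (Suc k) * \<theta>) * 2 powr (- (s * real k)))"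
      unfolding ab[of "Suc k"] using b0 by (simp add: powr_mult powr_powr)
    also have "2 powr (p * real k) * 2 powr (s * real (Suc k) * \<theta>) * 2 powr (- (s * real k))
        = 2 powr ((p + \<theta> * s - s) * real k + \<theta> * s)"
      by (simp add: powr_add[symmetric] algebra_simps)
    also have "D * b (Suc k) powr \<theta> * \<dots> = D' * b (Suc k) powr \<theta>"
      using s by (simp add: D'_def)
    also have "\<dots> \<le> D' * M powr \<theta>"
      using \<theta> b0 bM D by (intro mult_left_mono powr_mono2) (auto simp: D'_def)
    finally show ?thesis .
  qed
  then have MD: "M \<le> D' * M powr \<theta>" unfolding M_def by (intro cSUP_least) auto
  have "M \<le> D' powr (1 / (1 - \<theta>))"
  proof (cases "M = 0")
    case False
    then have Mp: "0 < M" using M0 by simp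
    have "M powr \<theta> * M powr (1 - \<theta>) = M" using Mp by (simp flip: powr_add)
    then have "M powr \<theta> * M powr (1 - \<theta>) \<le> M powr \<theta> * D'" using MD by (simp add: mult.commute)
    then have "M powr (1 - \<theta>) \<le> D'" using Mp by simp
    then have "(M powr (1 - \<theta>)) powr (1 / (1 - \<theta>)) \<le> D' powr (1 / (1 - \<theta>))"
      using \<theta> by (intro powr_mono2) auto
    then show ?thesis using \<theta> Mp by (simp add: powr_powr)
  qed simp
  then have "b k \<le> D' powr (1 / (1 - \<theta>))" using bM[of k] by linarith
  then show ?thesis unfolding ab D'_def by (intro mult_right_mono) auto
qed

text \<open>
  The weak form of the critical Sobolev inequality, at dyadic levels: here \<open>s\<close> is the critical
  exponent \<open>p*\<close>.
\<close>

lemma level_set_growth: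
  fixes u :: "int ^ 'n::finite \<Rightarrow> real"
  defines "N \<equiv> real CARD('n)"
  assumes u: "finsupp u" "\<And>x. 0 \<le> u x" and p: "1 \<le> p" "p < N"
  defines "s \<equiv> N * p / (N - p)"
  shows "real (card {x. (1/2) ^ k < u x})
    \<le> (2 * (8 * N) powr p * 2 powr (p / N * s) * energy p u) powr (N / (N - p)) * 2 powr (s * real k)"
proof -
  define a where "a k = real (card {x. (1/2) ^ k < u x})" for k
  define D where "D = 2 * (8 * N) powr p * energy p u"
  have N: "N \<ge> 1" by (simp add: N_def)
  have "a k \<le> (D * 2 powr (p / N * s)) powr (1 / (1 - p / N)) * 2 powr (s * real k)"
  proof (rule sublinear_recursion_bound)
    fix k
    show "0 \<le> a k" by (simp add: a_def)
    have "{x. (1/2) ^ k < u x} \<subseteq> {x. u x \<noteq> 0}"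
      by (auto simp: not_less)
    then have "card {x. (1/2) ^ k < u x} \<le> card {x. u x \<noteq> 0}"
      using u(1) by (intro card_mono) (auto simp: finsupp_def)
    then show "a k \<le> real (card {x. u x \<noteq> 0})" by (simp add: a_def)
    have eq: "4 * N / (1/2) ^ Suc k = 8 * N * 2 powr real k"
      by (simp add: powr_realpow power_one_over field_simps)
    have "a k \<le> 2 * (4 * N / (1/2) ^ Suc k) powr p * a (Suc k) powr (p / N) * energy p u"
      using level_set_estimate[OF u(1) p(1), of "(1/2) ^ Suc k"] by (simp add: a_def N_def)
    also have "\<dots> = D * 2 powr (p * real k) * a (Suc k) powr (p / N)"
      unfolding eq using N by (simp add: D_def powr_mult powr_powr mult_ac)
    finally show "a k \<le> D * 2 powr (p * real k) * a (Suc k) powr (p / N)" .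
  next
    show "p + p / N * s = s" using p N unfolding s_def by (simp add: field_simps)
  qed (use p N in \<open>auto simp: D_def s_def energy_nonneg\<close>)
  moreover have "1 / (1 - p / N) = N / (N - p)" using p N by (simp add: field_simps)
  moreover have "D * 2 powr (p / N * s) = 2 * (8 * N) powr p * 2 powr (p / N * s) * energy p u"
    by (simp add: D_def mult_ac)
  ultimately show ?thesis unfolding a_def by (simp only:)
qed

text \<open>
  Sum the weak inequality over dyadic levels: the points with
  \<open>u\<close> between \<open>(1/2) ^ (k + 1)\<close> and \<open>(1/2) ^ k\<close> contribute at most a constant times
  \<open>(2 powr (s - r)) ^ k\<close>, a convergent geometric series since \<open>r\<close> exceeds the critical \<open>s\<close>.
  The bound \<open>u \<le> 1\<close> restricts the sum to \<open>k \<ge> 0\<close>.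
\<close>

lemma supercritical_sobolev:
  fixes p r :: real
  defines "N \<equiv> real CARD('n::finite)"
  assumes p: "1 \<le> p" "p < N" and r: "N * p / (N - p) < r"
  obtains C where "0 < C"
    "\<And>u :: int ^ 'n \<Rightarrow> real. finsupp u \<Longrightarrow> (\<And>x. 0 \<le> u x \<and> u x \<le> 1) \<Longrightarrow>
       (\<Sum>\<^sub>\<infinity>x. u x powr r) \<le> C * energy p u powr (N / (N - p))"
proof -
  define s where "s = N * p / (N - p)"
  define K where "K = 2 * (8 * N) powr p * 2 powr (p / N * s)"
  define G where "G = 1 / (1 - 2 powr (s - r))"
  define C where "C = K powr (N / (N - p)) * 2 powr s * G"
  have N: "N \<ge> 1" by (simp add: N_def)
  have s: "0 \<le> s" "s < r" using p r N by (auto simp: s_def)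
  have ratio: "2 powr (s - r) < 1" using s powr_less_mono[of "s - r" 0 2] by simp
  then have G: "0 < G" by (simp add: G_def)
  have K: "0 < K" using N by (simp add: K_def)
  then have C: "0 < C" using G by (simp add: C_def)
  have "(\<Sum>\<^sub>\<infinity>x. u x powr r) \<le> C * energy p u powr (N / (N - p))"
    if u: "finsupp u" and u01: "\<And>x. 0 \<le> u x \<and> u x \<le> 1" for u :: "int ^ 'n \<Rightarrow> real"
  proof -
    define a where "a k = real (card {x. (1/2) ^ k < u x})" for k
    define H where "H = (K * energy p u) powr (N / (N - p))"
    have aH: "a k \<le> H * 2 powr (s * real k)" for k
      unfolding a_def H_def K_def s_def N_def
      using level_set_growth[OF u, of p k] u01 p by (simp add: N_def)
    have H0: "0 \<le> H" by (simp add: H_def)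
    define F where "F = {x. u x \<noteq> 0}"
    have F: "finite F" using u by (simp add: F_def finsupp_def)
    \<comment> \<open>The dyadic level of a point of the support.\<close>
    define \<kappa> where "\<kappa> x = (LEAST k. (1/2) ^ Suc k < u x)" for x
    have \<kappa>1: "(1/2) ^ Suc (\<kappa> x) < u x" if "x \<in> F" for x
    proof -
      have "0 < u x" using that u01[of x] by (auto simp: F_def less_le)
      then obtain k where k: "(1/2) ^ k < u x" using real_arch_pow_inv[of "u x" "1/2"] by auto
      have "(1/2 :: real) ^ Suc k \<le> (1/2) ^ k" by simp
      then have "(1/2) ^ Suc k < u x" using k by linarith
      then show ?thesis unfolding \<kappa>_def by (rule LeastI)
    qed
    have \<kappa>2: "u x \<le> (1/2) ^ \<kappa> x" for x
    proof (cases "\<kappa> x")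
      case 0
      then show ?thesis using u01 by simp
    next
      case (Suc j)
      then have "\<not> (1/2) ^ Suc j < u x" unfolding \<kappa>_def by (intro not_less_Least) simp
      then show ?thesis using Suc by simp
    qed
    have shell: "(\<Sum>x\<in>{x \<in> F. \<kappa> x = k}. u x powr r) \<le> H * 2 powr s * (2 powr (s - r)) ^ k" for k
    proof -
      have half: "((1/2) ^ k) powr r = 2 powr (- (r * real k))"
        by (simp add: powr_minus powr_divide power_one_over powr_powr mult.commute flip: powr_realpow)
           (simp add: inverse_eq_divide)
      have "(\<Sum>x\<in>{x \<in> F. \<kappa> x = k}. u x powr r) \<le> (\<Sum>x\<in>{x \<in> F. \<kappa> x = k}. 2 powr (- (r * real k)))"
        unfolding half[symmetric] using s \<kappa>2 u01
        by (intro sum_mono powr_mono2) auto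
      also have "\<dots> = real (card {x \<in> F. \<kappa> x = k}) * 2 powr (- (r * real k))" by simp
      also have "\<dots> \<le> a (Suc k) * 2 powr (- (r * real k))"
      proof (rule mult_right_mono)
        have "{x. (1/2) ^ Suc k < u x} \<subseteq> F" by (auto simp: F_def not_less)
        then have "finite {x. (1/2) ^ Suc k < u x}" using F finite_subset by blast
        then show "real (card {x \<in> F. \<kappa> x = k}) \<le> a (Suc k)"
          unfolding a_def using \<kappa>1 by (intro of_nat_mono card_mono) auto
      qed simp
      also have "\<dots> \<le> H * 2 powr (s * real (Suc k)) * 2 powr (- (r * real k))"
        by (intro mult_right_mono aH) auto
      also have "\<dots> = H * (2 powr (s * real (Suc k)) * 2 powr (- (r * real k)))" by simp
      also have "2 powr (s * real (Suc k)) * 2 powr (- (r * real k)) = 2 powr s * (2 powr (s - r)) ^ k"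
        by (simp add: powr_powr algebra_simps flip: powr_realpow powr_add)
      finally show ?thesis by simp
    qed
    have "(\<Sum>\<^sub>\<infinity>x. u x powr r) = (\<Sum>x\<in>F. u x powr r)"
      by (rule infsum_finite_support[OF F]) (simp add: F_def)
    also have "\<dots> = (\<Sum>k\<in>\<kappa> ` F. \<Sum>x\<in>{x \<in> F. \<kappa> x = k}. u x powr r)"
      using F by (rule sum.image_gen)
    also have "\<dots> \<le> (\<Sum>k\<in>\<kappa> ` F. H * 2 powr s * (2 powr (s - r)) ^ k)"
      by (intro sum_mono shell)
    also have "\<dots> = H * 2 powr s * (\<Sum>k\<in>\<kappa> ` F. (2 powr (s - r)) ^ k)"
      by (simp add: sum_distrib_left)
    also have "\<dots> \<le> H * 2 powr s * (\<Sum>k. (2 powr (s - r)) ^ k)"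
      using ratio H0 F by (intro mult_left_mono sum_le_suminf summable_geometric) auto
    also have "(\<Sum>k. (2 powr (s - r)) ^ k) = G"
      using suminf_geometric[of "2 powr (s - r)"] ratio by (simp add: G_def)
    also have "H = K powr (N / (N - p)) * energy p u powr (N / (N - p))"
      unfolding H_def by (rule powr_mult)
    finally show ?thesis by (simp add: C_def mult_ac)
  qed
  with C show ?thesis by (rule that)
qed

section \<open>Changing a function at one point\<close>

lemma DERIV_abs_diff_powr:
  fixes a p :: real
  assumes "1 < p"
  shows "((\<lambda>t. \<bar>a - t\<bar> powr p) has_real_derivative - (p * (\<bar>a\<bar> powr (p - 2) * a))) (at 0)"
proof -
  consider "a = 0" | "a > 0" | "a < 0" by linarith
  then show ?thesis
  proof cases
    case 1
    have "(\<lambda>h::real. \<bar>h\<bar> powr (p - 1)) \<midarrow>0\<rightarrow> \<bar>0\<bar> powr (p - 1)"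
      using assms by (intro tendsto_powr' tendsto_intros) auto
    then have "(\<lambda>h::real. \<bar>h\<bar> powr (p - 1)) \<midarrow>0\<rightarrow> 0" by simp
    then have "(\<lambda>h::real. \<bar>h\<bar> powr p / h) \<midarrow>0\<rightarrow> 0"
    proof (rule Lim_null_comparison[rotated])
      show "\<forall>\<^sub>F h in at 0. norm (\<bar>h\<bar> powr p / h) \<le> \<bar>h\<bar> powr (p - 1)"
        by (auto simp: powr_diff abs_divide eventually_at intro!: exI[of _ 1])
    qed
    then show ?thesis using 1 by (simp add: DERIV_def)
  next
    case 2
    have "((\<lambda>t. (a - t) powr p) has_real_derivative p * (a - 0) powr (p - of_nat 1) * - 1) (at 0)"
      using 2 by (intro DERIV_fun_powr) (auto intro!: derivative_eq_intros)
    moreover have "\<bar>a\<bar> powr (p - 2) * a = a powr (p - 1)"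
      using 2 powr_add[of a "p - 2" 1] by simp
    ultimately have "((\<lambda>t. (a - t) powr p) has_real_derivative - (p * (\<bar>a\<bar> powr (p - 2) * a))) (at 0)"
      by simp
    then show ?thesis
      by (rule has_field_derivative_transform_within_open[of _ _ _ "{..<a}"]) (use 2 in auto)
  next
    case 3
    have "((\<lambda>t. (t - a) powr p) has_real_derivative p * (0 - a) powr (p - of_nat 1) * 1) (at 0)"
      using 3 by (intro DERIV_fun_powr) (auto intro!: derivative_eq_intros)
    moreover have "\<bar>a\<bar> powr (p - 2) * a = - ((- a) powr (p - 1))"
      using 3 powr_add[of "- a" "p - 2" 1] by simp
    ultimately have "((\<lambda>t. (t - a) powr p) has_real_derivative - (p * (\<bar>a\<bar> powr (p - 2) * a))) (at 0)"
      by simp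
    then show ?thesis
      by (rule has_field_derivative_transform_within_open[of _ _ _ "{a<..}"]) (use 3 in auto)
  qed
qed

text \<open>
  Makes the effect of a local change of a function a finite sum.
\<close>

lemma infsum_finite_change:
  fixes f g :: "'a \<Rightarrow> real"
  assumes "finsupp g" "finite F" "\<And>x. x \<notin> F \<Longrightarrow> f x = g x"
  shows "(\<Sum>\<^sub>\<infinity>x. f x) = (\<Sum>\<^sub>\<infinity>x. g x) + (\<Sum>x\<in>F. f x - g x)"
proof -
  have h: "(\<Sum>\<^sub>\<infinity>x. f x - g x) = (\<Sum>x\<in>F. f x - g x)"
    using assms by (intro infsum_finite_support) auto
  have "finsupp (\<lambda>x. f x - g x)"
    unfolding finsupp_def by (rule finite_subset[OF _ assms(2)]) (use assms(3) in force)
  then have "(\<Sum>\<^sub>\<infinity>x. g x + (f x - g x)) = (\<Sum>\<^sub>\<infinity>x. g x) + (\<Sum>\<^sub>\<infinity>x. f x - g x)"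
    using assms(1) by (intro infsum_add finsupp_summable)
  then show ?thesis by (simp add: h)
qed

lemma energy_update:
  fixes u :: "int ^ 'n::finite \<Rightarrow> real"
  assumes u: "finsupp u"
  shows "energy p (u(x := u x + t)) = energy p u
    + (\<Sum>y | x \<sim>\<^sub>Z y. \<bar>u y - u x - t\<bar> powr p - \<bar>u y - u x\<bar> powr p)"
proof -
  let ?w = "u(x := u x + t)"
  let ?d = "\<lambda>y. \<bar>u y - u x - t\<bar> powr p - \<bar>u y - u x\<bar> powr p"
  have "increment_energy p (axis i 1) ?w = increment_energy p (axis i 1) u
      + (?d (x + axis i 1) + ?d (x - axis i 1))" for i
  proof -
    let ?e = "axis i 1 :: int ^ 'n"
    have e: "?e \<noteq> 0" by (simp add: axis_eq_0_iff)
    have "increment_energy p ?e ?w = increment_energy p ?e u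
      + (\<Sum>z\<in>{x, x - ?e}. \<bar>?w (z + ?e) - ?w z\<bar> powr p - \<bar>u (z + ?e) - u z\<bar> powr p)"
      unfolding increment_energy_def
    proof (rule infsum_finite_change)
      show "finsupp (\<lambda>z. \<bar>u (z + ?e) - u z\<bar> powr p)" by (rule finsupp_increment[OF u])
      fix z assume "z \<notin> {x, x - ?e}"
      then have "z \<noteq> x" "z + ?e \<noteq> x" by auto
      then show "\<bar>?w (z + ?e) - ?w z\<bar> powr p = \<bar>u (z + ?e) - u z\<bar> powr p" by simp
    qed simp
    also have "(\<Sum>z\<in>{x, x - ?e}. \<bar>?w (z + ?e) - ?w z\<bar> powr p - \<bar>u (z + ?e) - u z\<bar> powr p)
        = ?d (x + ?e) + ?d (x - ?e)"
      using e by (simp add: algebra_simps abs_minus_commute)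
    finally show ?thesis .
  qed
  then show ?thesis unfolding energy_def sum_neighbours by (simp add: sum.distrib)
qed

lemma infsum_powr_update:
  assumes "finsupp u"
  shows "(\<Sum>\<^sub>\<infinity>y. \<bar>(u(x := u x + t)) y\<bar> powr q)
    = (\<Sum>\<^sub>\<infinity>y. \<bar>u y\<bar> powr q) + (\<bar>u x + t\<bar> powr q - \<bar>u x\<bar> powr q)"
  using infsum_finite_change[OF finsupp_compose[OF assms, of "\<lambda>a. \<bar>a\<bar> powr q"], of "{x}"
      "\<lambda>y. \<bar>(u(x := u x + t)) y\<bar> powr q"] by simp

section \<open>The best Sobolev constant and its near minimisers\<close>

definition unit_functions :: "real \<Rightarrow> ('a \<Rightarrow> real) set" where
  "unit_functions q = {w. finsupp w \<and> (\<Sum>\<^sub>\<infinity>x. \<bar>w x\<bar> powr q) = 1}"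

text \<open>
  The type argument fixes the dimension, which the values \<open>p\<close> and \<open>q\<close> do not determine.
\<close>

definition sobolev_constant :: "'n::finite itself \<Rightarrow> real \<Rightarrow> real \<Rightarrow> real" where
  "sobolev_constant _ p q = (INF w\<in>(unit_functions q :: (int ^ 'n \<Rightarrow> real) set). energy p w)"

lemma unit_function_le_1:
  assumes "w \<in> unit_functions q" "0 < q"
  shows "\<bar>w x\<bar> \<le> 1"
proof (rule ccontr)
  assume "\<not> \<bar>w x\<bar> \<le> 1"
  then have "1 < \<bar>w x\<bar> powr q" using assms(2) by (intro gr_one_powr) auto
  moreover have "(\<Sum>y\<in>{x}. \<bar>w y\<bar> powr q) \<le> (\<Sum>\<^sub>\<infinity>y. \<bar>w y\<bar> powr q)"
    using assms(1) unfolding unit_functions_def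
    by (intro finite_sum_le_infsum finsupp_summable finsupp_compose[of w "\<lambda>a. \<bar>a\<bar> powr q"]) auto
  ultimately show False using assms(1) by (simp add: unit_functions_def)
qed

lemma abs_unit_function:
  fixes w :: "int ^ 'n::finite \<Rightarrow> real"
  assumes "w \<in> unit_functions q" "0 \<le> p"
  shows "(\<lambda>x. \<bar>w x\<bar>) \<in> unit_functions q" "energy p (\<lambda>x. \<bar>w x\<bar>) \<le> energy p w"
proof -
  have w: "finsupp w" using assms(1) by (simp add: unit_functions_def)
  then have a: "finsupp (\<lambda>x. \<bar>w x\<bar>)" by (rule finsupp_compose) simp
  with assms(1) show "(\<lambda>x. \<bar>w x\<bar>) \<in> unit_functions q" by (simp add: unit_functions_def)
  show "energy p (\<lambda>x. \<bar>w x\<bar>) \<le> energy p w"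
    using w a assms(2) by (intro energy_mono) auto
qed

lemma sobolev_constant_le:
  fixes w :: "int ^ 'n::finite \<Rightarrow> real"
  assumes "w \<in> unit_functions q"
  shows "sobolev_constant TYPE('n) p q \<le> energy p w"
  unfolding sobolev_constant_def
  by (rule cINF_lower[OF _ assms]) (auto intro!: bdd_belowI2[of _ 0] energy_nonneg)

lemma sobolev_inequality:
  fixes w :: "int ^ 'n::finite \<Rightarrow> real"
  assumes w: "finsupp w" and q: "0 < q" and p: "0 \<le> p"
  shows "sobolev_constant TYPE('n) p q * (\<Sum>\<^sub>\<infinity>x. \<bar>w x\<bar> powr q) powr (p / q) \<le> energy p w"
proof -
  define m where "m = (\<Sum>\<^sub>\<infinity>x. \<bar>w x\<bar> powr q)"
  have m0: "0 \<le> m" unfolding m_def by (rule infsum_nonneg) simp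
  show ?thesis
  proof (cases "m = 0")
    case True
    then show ?thesis by (simp add: m_def energy_nonneg)
  next
    case False
    then have m: "0 < m" using m0 by simp
    define c where "c = m powr (- (1 / q))"
    have c: "0 < c" using m by (simp add: c_def)
    have cw: "finsupp (\<lambda>x. c * w x)" using w by (rule finsupp_compose) simp
    have "(\<Sum>\<^sub>\<infinity>x. \<bar>c * w x\<bar> powr q) = c powr q * m"
      using c unfolding m_def by (simp add: abs_mult powr_mult infsum_cmult_right')
    also have "c powr q = m powr (- 1)" using q by (simp add: c_def powr_powr)
    also have "\<dots> = 1 / m" using m by (simp add: powr_minus_divide)
    finally have "(\<lambda>x. c * w x) \<in> unit_functions q" using cw m by (simp add: unit_functions_def)
    then have "sobolev_constant TYPE('n) p q \<le> energy p (\<lambda>x. c * w x)"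
      by (rule sobolev_constant_le)
    also have "\<dots> = energy p w * m powr (- (p / q))"
      using energy_scale[of c p w] c by (simp add: c_def powr_powr)
    finally have "sobolev_constant TYPE('n) p q * m powr (p / q)
        \<le> energy p w * m powr (- (p / q)) * m powr (p / q)"
      by (rule mult_right_mono) simp
    also have "\<dots> = energy p w" using m by (simp add: mult.assoc flip: powr_add)
    finally show ?thesis by (simp add: m_def)
  qed
qed

lemma unit_functions_nonempty: "unit_functions q \<noteq> {}"
proof -
  fix a :: 'a
  let ?d = "\<lambda>x. if x = a then 1 else 0 :: real"
  have "finsupp ?d" by (simp add: finsupp_def)
  moreover have "(\<Sum>\<^sub>\<infinity>x. \<bar>?d x\<bar> powr q) = 1"
    by (subst infsum_finite_support[of "{a}"]) auto
  ultimately have "?d \<in> unit_functions q" by (simp add: unit_functions_def)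
  then show ?thesis by blast
qed

text \<open>
  Normalised functions are bounded by \<open>1\<close>, so the Sobolev inequality with \<open>r = q\<close> applies to their
  absolute values and bounds their energy away from zero.
\<close>

lemma sobolev_constant_pos:
  fixes p q :: real
  defines "N \<equiv> real CARD('n::finite)"
  assumes p: "1 \<le> p" "p < N" and q: "N * p / (N - p) < q"
  shows "0 < sobolev_constant TYPE('n) p q"
proof -
  obtain C where C: "0 < C"
    "\<And>u :: int ^ 'n \<Rightarrow> real. finsupp u \<Longrightarrow> (\<And>x. 0 \<le> u x \<and> u x \<le> 1) \<Longrightarrow>
       (\<Sum>\<^sub>\<infinity>x. u x powr q) \<le> C * energy p u powr (N / (N - p))"
    using supercritical_sobolev[where 'n = 'n, of p q] p q unfolding N_def by blast
  have q0: "0 < q" using q p by (smt (verit) divide_nonneg_pos mult_nonneg_nonneg)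
  let ?b = "N / (N - p)"
  have b: "0 < ?b" using p by simp
  have "(1 / C) powr (1 / ?b) \<le> energy p w" if w: "w \<in> unit_functions q" for w :: "int ^ 'n \<Rightarrow> real"
  proof -
    have aw: "(\<lambda>x. \<bar>w x\<bar>) \<in> unit_functions q" "energy p (\<lambda>x. \<bar>w x\<bar>) \<le> energy p w"
      using abs_unit_function[OF w] p by auto
    have "1 \<le> C * energy p (\<lambda>x. \<bar>w x\<bar>) powr ?b"
      using C(2)[of "\<lambda>x. \<bar>w x\<bar>"] aw(1) unit_function_le_1[OF w q0] by (simp add: unit_functions_def)
    also have "\<dots> \<le> C * energy p w powr ?b"
      using C(1) aw(2) b by (intro mult_left_mono powr_mono2 energy_nonneg) auto
    finally have "1 / C \<le> energy p w powr ?b" using C(1) by (simp add: divide_le_eq mult.commute)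
    then have "(1 / C) powr (1 / ?b) \<le> (energy p w powr ?b) powr (1 / ?b)"
      using C(1) b p by (intro powr_mono2) auto
    also have "\<dots> = energy p w" using b p energy_nonneg[of p w] by (simp add: powr_powr)
    finally show ?thesis .
  qed
  then have "(1 / C) powr (1 / ?b) \<le> sobolev_constant TYPE('n) p q"
    unfolding sobolev_constant_def by (intro cINF_greatest unit_functions_nonempty)
  moreover have "0 < (1 / C) powr (1 / ?b)" using C(1) by simp
  ultimately show ?thesis by linarith
qed

text \<open>
  The exponent \<open>r\<close> lies halfway between the critical one and \<open>q\<close>. A near minimiser
  has \<open>\<Sum> v powr r \<le> B\<close>. If it were at most \<open>\<delta>\<close> everywhere, then \<open>\<Sum> v powr q\<close> would be at most
  \<open>\<delta> powr (q - r) * B\<close>, which is \<open>1 / 2\<close> by the choice of \<open>\<delta>\<close>. So it exceeds \<open>\<delta>\<close> somewhere, and a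
  translation moves that point to the origin.
\<close>

lemma near_minimizers_at_origin:
  fixes p q :: real
  defines "N \<equiv> real CARD('n::finite)"
  assumes p: "1 \<le> p" "p < N" and q: "N * p / (N - p) < q"
  obtains \<delta> where "0 < \<delta>"
    "\<And>\<epsilon>. 0 < \<epsilon> \<Longrightarrow> \<epsilon> \<le> 1 \<Longrightarrow> \<exists>v :: int ^ 'n \<Rightarrow> real. v \<in> unit_functions q \<and> (\<forall>x. 0 \<le> v x) \<and>
       energy p v < sobolev_constant TYPE('n) p q + \<epsilon> \<and> \<delta> < v 0"
proof -
  define S where "S = sobolev_constant TYPE('n) p q"
  define s where "s = N * p / (N - p)"
  define r where "r = (s + q) / 2"
  have s0: "0 \<le> s" using p by (simp add: s_def)
  have "s < q" using q by (simp add: s_def)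
  then have r: "s < r" "r < q" by (simp_all add: r_def)
  have S: "0 < S" unfolding S_def using p q by (intro sobolev_constant_pos) (auto simp: N_def)
  obtain C where C: "0 < C"
    "\<And>u :: int ^ 'n \<Rightarrow> real. finsupp u \<Longrightarrow> (\<And>x. 0 \<le> u x \<and> u x \<le> 1) \<Longrightarrow>
       (\<Sum>\<^sub>\<infinity>x. u x powr r) \<le> C * energy p u powr (N / (N - p))"
    using supercritical_sobolev[where 'n = 'n, of p r] p r(1) unfolding N_def s_def by blast
  define B where "B = C * (S + 1) powr (N / (N - p))"
  have B: "0 < B" using C S by (simp add: B_def)
  define \<delta> where "\<delta> = (1 / (2 * B)) powr (1 / (q - r))"
  have \<delta>: "0 < \<delta>" using B by (simp add: \<delta>_def)
  have \<delta>B: "\<delta> powr (q - r) * B = 1 / 2" using B r by (simp add: \<delta>_def powr_powr)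
  have "\<exists>v :: int ^ 'n \<Rightarrow> real. v \<in> unit_functions q \<and> (\<forall>x. 0 \<le> v x) \<and> energy p v < S + \<epsilon> \<and> \<delta> < v 0"
    if \<epsilon>: "0 < \<epsilon>" "\<epsilon> \<le> 1" for \<epsilon>
  proof -
    have "(INF w\<in>(unit_functions q :: (int ^ 'n \<Rightarrow> real) set). energy p w) < S + \<epsilon>"
      using \<epsilon> by (simp add: S_def sobolev_constant_def)
    then obtain w :: "int ^ 'n \<Rightarrow> real" where w: "w \<in> unit_functions q" "energy p w < S + \<epsilon>"
      by (subst (asm) cINF_less_iff) (auto intro!: unit_functions_nonempty bdd_belowI2[of _ 0] energy_nonneg)
    define v where "v x = \<bar>w x\<bar>" for x
    have v: "v \<in> unit_functions q" "energy p v \<le> energy p w"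
      using abs_unit_function[OF w(1)] p unfolding v_def by auto
    have fin: "finsupp v" and one: "(\<Sum>\<^sub>\<infinity>x. v x powr q) = 1"
      using v(1) by (auto simp: unit_functions_def v_def)
    have v01: "0 \<le> v x \<and> v x \<le> 1" for x
      using unit_function_le_1[OF w(1), of x] r s0 by (simp add: v_def)
    have "\<exists>x. \<delta> < v x"
    proof (rule ccontr)
      assume "\<not> (\<exists>x. \<delta> < v x)"
      then have le: "v x \<le> \<delta>" for x by (simp add: not_less)
      have "1 = (\<Sum>\<^sub>\<infinity>x. v x powr q)" using one by simp
      also have "\<dots> \<le> (\<Sum>\<^sub>\<infinity>x. \<delta> powr (q - r) * v x powr r)"
      proof (intro infsum_mono finsupp_summable)
        show "finsupp (\<lambda>x. v x powr q)" by (rule finsupp_compose[OF fin]) simp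
        show "finsupp (\<lambda>x. \<delta> powr (q - r) * v x powr r)"
          by (rule finsupp_compose[OF fin, of "\<lambda>a. \<delta> powr (q - r) * a powr r"]) simp
        fix x
        have "v x powr q = v x powr (q - r) * v x powr r" by (simp flip: powr_add)
        also have "\<dots> \<le> \<delta> powr (q - r) * v x powr r"
          using v01 le r by (intro mult_right_mono powr_mono2) auto
        finally show "v x powr q \<le> \<delta> powr (q - r) * v x powr r" .
      qed
      also have "\<dots> = \<delta> powr (q - r) * (\<Sum>\<^sub>\<infinity>x. v x powr r)" by (rule infsum_cmult_right')
      also have "\<dots> \<le> \<delta> powr (q - r) * B"
      proof (rule mult_left_mono)
        have "(\<Sum>\<^sub>\<infinity>x. v x powr r) \<le> C * energy p v powr (N / (N - p))"
          using C(2)[OF fin] v01 by blast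
        also have "\<dots> \<le> B" unfolding B_def
          using C(1) p v(2) w(2) \<epsilon> by (intro mult_left_mono powr_mono2 energy_nonneg) auto
        finally show "(\<Sum>\<^sub>\<infinity>x. v x powr r) \<le> B" .
      qed simp
      also have "\<dots> = 1 / 2" by (rule \<delta>B)
      finally show False by simp
    qed
    then obtain a where a: "\<delta> < v a" ..
    define v' where "v' x = v (x + a)" for x
    have "(\<Sum>\<^sub>\<infinity>x. \<bar>v' x\<bar> powr q) = 1"
      using infsum_shift[of "\<lambda>x. \<bar>v x\<bar> powr q" a] v(1) by (simp add: v'_def unit_functions_def)
    then have "v' \<in> unit_functions q"
      unfolding unit_functions_def using finsupp_shift[OF fin, of a] by (simp add: v'_def[abs_def])
    moreover have "energy p v' = energy p v" unfolding v'_def by (rule energy_shift)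
    ultimately show ?thesis using v01 v(2) w(2) a
      by (intro exI[of _ v']) (auto simp: v'_def)
  qed
  then show ?thesis using \<delta> unfolding S_def by (intro that) auto
qed

section \<open>The equation for the limit of near minimisers\<close>

text \<open>
  The two sides of the hypothesis agree at \<open>t = 0\<close>, so their difference \<open>g\<close> has a minimum
  there and \<open>g' 0 = 0\<close>. The factor \<open>p\<close> common to both derivatives cancels.
\<close>

lemma euler_lagrange_of_minimum:
  fixes u :: "int ^ 'n::finite \<Rightarrow> real"
  assumes p: "1 < p" and q: "1 < q"
    and min: "\<And>t. S * (1 + (\<bar>u x + t\<bar> powr q - \<bar>u x\<bar> powr q)) powr (p / q)
       \<le> S + (\<Sum>y | x \<sim>\<^sub>Z y. \<bar>u y - u x - t\<bar> powr p - \<bar>u y - u x\<bar> powr p)"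
  shows "p_laplacian p u x + S * (\<bar>u x\<bar> powr (q - 2) * u x) = 0"
proof -
  define g where "g t = S + (\<Sum>y | x \<sim>\<^sub>Z y. \<bar>(u y - u x) - t\<bar> powr p - \<bar>u y - u x\<bar> powr p)
     - S * (1 + (\<bar>- u x - t\<bar> powr q - \<bar>u x\<bar> powr q)) powr (p / q)" for t
  define h where "h t = 1 + (\<bar>- u x - t\<bar> powr q - \<bar>u x\<bar> powr q)" for t
  have "(h has_real_derivative 0 + (- (q * (\<bar>- u x\<bar> powr (q - 2) * - u x)) - 0)) (at 0)"
    unfolding h_def by (intro DERIV_add DERIV_diff DERIV_const DERIV_abs_diff_powr q)
  then have h: "(h has_real_derivative q * (\<bar>u x\<bar> powr (q - 2) * u x)) (at 0)" by simp
  have "((\<lambda>t. h t powr (p / q)) has_real_derivative p / q * h 0 powr (p / q - of_nat 1) * (q * (\<bar>u x\<bar> powr (q - 2) * u x))) (at 0)"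
    by (rule DERIV_fun_powr[OF h]) (simp add: h_def)
  then have hp: "((\<lambda>t. h t powr (p / q)) has_real_derivative p * (\<bar>u x\<bar> powr (q - 2) * u x)) (at 0)"
    using q by (simp add: h_def)
  have "((\<lambda>t. \<Sum>y | x \<sim>\<^sub>Z y. \<bar>(u y - u x) - t\<bar> powr p - \<bar>u y - u x\<bar> powr p) has_real_derivative
      (\<Sum>y | x \<sim>\<^sub>Z y. - (p * (\<bar>u y - u x\<bar> powr (p - 2) * (u y - u x))) - 0)) (at 0)"
    by (intro DERIV_sum DERIV_diff DERIV_const DERIV_abs_diff_powr p)
  also have "(\<Sum>y | x \<sim>\<^sub>Z y. - (p * (\<bar>u y - u x\<bar> powr (p - 2) * (u y - u x))) - 0) = - (p * p_laplacian p u x)"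
    by (simp add: p_laplacian_def sum_distrib_left sum_negf)
  finally have "(g has_real_derivative (0 + - (p * p_laplacian p u x) - S * (p * (\<bar>u x\<bar> powr (q - 2) * u x)))) (at 0)"
    unfolding g_def h_def[symmetric] by (intro DERIV_diff DERIV_add DERIV_const DERIV_cmult hp)
  moreover have "g 0 \<le> g t" for t
  proof -
    have "\<bar>u x + t\<bar> = \<bar>- u x - t\<bar>" by linarith
    then show ?thesis using min[of t] by (simp add: g_def)
  qed
  ultimately have "0 + - (p * p_laplacian p u x) - S * (p * (\<bar>u x\<bar> powr (q - 2) * u x)) = 0"
    by (intro DERIV_local_min[of g _ 0 1]) auto
  then have "p * (p_laplacian p u x + S * (\<bar>u x\<bar> powr (q - 2) * u x)) = 0"
    by (simp add: algebra_simps)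
  then show ?thesis using p by simp
qed

text \<open>
  A zero of \<open>u\<close> next to a positive value would make the Laplacian at the
  zero positive. Hence positivity spreads from the origin along edges.
\<close>

lemma strong_maximum_principle:
  fixes u :: "int ^ 'n::finite \<Rightarrow> real"
  assumes nonneg: "\<And>x. 0 \<le> u x" and super: "\<And>x. p_laplacian p u x \<le> 0" and "0 < u 0"
  shows "0 < u x"
proof (rule lattice_induct[where P = "\<lambda>x. 0 < u x"])
  fix x y :: "int ^ 'n" assume x: "0 < u x" and xy: "x \<sim>\<^sub>Z y"
  show "0 < u y"
  proof (rule ccontr)
    assume "\<not> 0 < u y"
    then have y: "u y = 0" using nonneg[of y] by simp
    have "0 < \<bar>u x - u y\<bar> powr (p - 2) * (u x - u y)" using x y by simp
    also have "\<dots> \<le> p_laplacian p u y"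
      unfolding p_laplacian_def
      by (rule member_le_sum) (use nonneg y adj_sym[OF xy] finite_neighbours in auto)
    finally show False using super[of y] by simp
  qed
qed (rule assms)

lemma p_laplacian_scale:
  assumes "0 < c"
  shows "p_laplacian p (\<lambda>x. c * u x) x = c powr (p - 1) * p_laplacian p u x"
proof -
  have "\<bar>c * u y - c * u x\<bar> powr (p - 2) * (c * u y - c * u x)
      = c powr (p - 1) * (\<bar>u y - u x\<bar> powr (p - 2) * (u y - u x))" for y
  proof -
    have "c powr (p - 1) = c powr (p - 2) * c" using assms powr_add[of c "p - 2" 1] by simp
    moreover have "\<bar>c * u y - c * u x\<bar> = c * \<bar>u y - u x\<bar>"
      using assms by (simp add: abs_mult flip: right_diff_distrib)
    ultimately show ?thesis using assms by (simp add: powr_mult algebra_simps)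
  qed
  then show ?thesis by (simp add: p_laplacian_def sum_distrib_left)
qed

text \<open>
  \<open>V n\<close> is a near minimiser with excess below \<open>1 / (n + 1)\<close>, and \<open>u\<close> is the pointwise limit of a
  subsequence. Normalised near minimisers are bounded by \<open>1\<close>, which gives the compactness.
\<close>

lemma p_laplacian_solution_with_multiplier:
  fixes p q :: real
  defines "N \<equiv> real CARD('n::finite)"
  assumes p: "1 < p" "p < N" and q: "N * p / (N - p) < q"
  obtains S and u :: "int ^ 'n \<Rightarrow> real" where "0 < S" "\<And>x. 0 < u x"
    "\<And>x. p_laplacian p u x + S * u x powr (q - 1) = 0"
proof -
  define S where "S = sobolev_constant TYPE('n) p q"
  have S: "0 < S" unfolding S_def using p q by (intro sobolev_constant_pos) (auto simp: N_def)
  have "p < N * p / (N - p)" using p by (simp add: field_simps)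
  then have pq: "p < q" and q1: "1 < q" using q p by auto
  obtain \<delta> where \<delta>: "0 < \<delta>"
    and ex: "\<And>\<epsilon>. 0 < \<epsilon> \<Longrightarrow> \<epsilon> \<le> 1 \<Longrightarrow> \<exists>v :: int ^ 'n \<Rightarrow> real. v \<in> unit_functions q \<and> (\<forall>x. 0 \<le> v x) \<and>
       energy p v < S + \<epsilon> \<and> \<delta> < v 0"
    using near_minimizers_at_origin[where 'n = 'n, of p q] p q unfolding N_def S_def by (metis less_imp_le)
  have "\<forall>n. \<exists>v :: int ^ 'n \<Rightarrow> real. v \<in> unit_functions q \<and> (\<forall>x. 0 \<le> v x) \<and>
       energy p v < S + 1 / real (Suc n) \<and> \<delta> < v 0"
    by (intro allI ex) auto
  then obtain V :: "nat \<Rightarrow> int ^ 'n \<Rightarrow> real" where V: "\<And>n. V n \<in> unit_functions q" "\<And>n x. 0 \<le> V n x"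
      "\<And>n. energy p (V n) < S + 1 / real (Suc n)" "\<And>n. \<delta> < V n 0"
    by metis
  have "norm (V n x) \<le> 1" for n x
    using unit_function_le_1[OF V(1), of n x] q1 by simp
  then obtain k where k: "strict_mono k" "\<And>x. \<exists>l. (\<lambda>n. V (k n) x) \<longlonglongrightarrow> l"
    using function_convergent_subsequence[of "UNIV :: (int ^ 'n) set" V 1] by (metis UNIV_I countableI_type)
  then obtain u where u: "\<And>x. (\<lambda>n. V (k n) x) \<longlonglongrightarrow> u x" by metis
  have u_nonneg: "0 \<le> u x" for x
    by (rule LIMSEQ_le_const[OF u]) (use V(2) in auto)
  have "\<delta> \<le> u 0"
    by (rule LIMSEQ_le_const[OF u]) (use V(4) in \<open>auto intro: less_imp_le\<close>)
  then have u0: "0 < u 0" using \<delta> by simp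
  have E: "(\<lambda>n. energy p (V (k n))) \<longlonglongrightarrow> S"
  proof (rule tendsto_sandwich)
    show "\<forall>\<^sub>F n in sequentially. S \<le> energy p (V (k n))"
      unfolding S_def by (intro always_eventually allI sobolev_constant_le V)
    show "\<forall>\<^sub>F n in sequentially. energy p (V (k n)) \<le> S + 1 / real (Suc (k n))"
      using V(3) by (intro always_eventually allI less_imp_le)
    have "(\<lambda>n. 1 / real (Suc n)) \<longlonglongrightarrow> 0"
      using LIMSEQ_inverse_real_of_nat by (simp add: inverse_eq_divide)
    then have "(\<lambda>n. 1 / real (Suc (k n))) \<longlonglongrightarrow> 0"
      using LIMSEQ_subseq_LIMSEQ[OF _ k(1)] by (auto simp: o_def)
    then show "(\<lambda>n. S + 1 / real (Suc (k n))) \<longlonglongrightarrow> S"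
      using tendsto_add[OF tendsto_const[of S]] by fastforce
  qed simp
  have EL: "p_laplacian p u x + S * (\<bar>u x\<bar> powr (q - 2) * u x) = 0" for x
  proof (rule euler_lagrange_of_minimum[OF p(1) q1])
    fix t
    \<comment> \<open>The Sobolev inequality for \<open>V n\<close> changed at \<open>x\<close> by \<open>t\<close>. All terms except the total energy of \<open>V n\<close> are local.\<close>
    have mass: "0 \<le> 1 + (\<bar>V n x + t\<bar> powr q - \<bar>V n x\<bar> powr q)"
      and ineq: "S * (1 + (\<bar>V n x + t\<bar> powr q - \<bar>V n x\<bar> powr q)) powr (p / q)
        \<le> energy p (V n) + (\<Sum>y | x \<sim>\<^sub>Z y. \<bar>V n y - V n x - t\<bar> powr p - \<bar>V n y - V n x\<bar> powr p)" for n
    proof -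
      let ?w = "(V n)(x := V n x + t)"
      have fin: "finsupp (V n)" and one: "(\<Sum>\<^sub>\<infinity>y. \<bar>V n y\<bar> powr q) = 1"
        using V(1)[of n] by (auto simp: unit_functions_def)
      have w: "finsupp ?w"
        unfolding finsupp_def
        by (rule finite_subset[of _ "insert x {y. V n y \<noteq> 0}"]) (use fin in \<open>auto simp: finsupp_def\<close>)
      have "S * (\<Sum>\<^sub>\<infinity>y. \<bar>?w y\<bar> powr q) powr (p / q) \<le> energy p ?w"
        unfolding S_def by (rule sobolev_inequality[OF w]) (use p q1 in simp_all)
      moreover have "0 \<le> (\<Sum>\<^sub>\<infinity>y. \<bar>?w y\<bar> powr q)" by (rule infsum_nonneg) simp
      ultimately show "0 \<le> 1 + (\<bar>V n x + t\<bar> powr q - \<bar>V n x\<bar> powr q)"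
        "S * (1 + (\<bar>V n x + t\<bar> powr q - \<bar>V n x\<bar> powr q)) powr (p / q)
        \<le> energy p (V n) + (\<Sum>y | x \<sim>\<^sub>Z y. \<bar>V n y - V n x - t\<bar> powr p - \<bar>V n y - V n x\<bar> powr p)"
        unfolding infsum_powr_update[OF fin] energy_update[OF fin] one by auto
    qed
    show "S * (1 + (\<bar>u x + t\<bar> powr q - \<bar>u x\<bar> powr q)) powr (p / q)
       \<le> S + (\<Sum>y | x \<sim>\<^sub>Z y. \<bar>u y - u x - t\<bar> powr p - \<bar>u y - u x\<bar> powr p)"
    proof (rule LIMSEQ_le)
      show "(\<lambda>n. S * (1 + (\<bar>V (k n) x + t\<bar> powr q - \<bar>V (k n) x\<bar> powr q)) powr (p / q))
        \<longlonglongrightarrow> S * (1 + (\<bar>u x + t\<bar> powr q - \<bar>u x\<bar> powr q)) powr (p / q)"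
        using p q1 mass
        by (intro tendsto_mult tendsto_powr' tendsto_add tendsto_diff tendsto_const tendsto_rabs u) auto
      show "(\<lambda>n. energy p (V (k n)) + (\<Sum>y | x \<sim>\<^sub>Z y. \<bar>V (k n) y - V (k n) x - t\<bar> powr p - \<bar>V (k n) y - V (k n) x\<bar> powr p))
        \<longlonglongrightarrow> S + (\<Sum>y | x \<sim>\<^sub>Z y. \<bar>u y - u x - t\<bar> powr p - \<bar>u y - u x\<bar> powr p)"
        using p by (intro tendsto_add E tendsto_sum tendsto_powr' tendsto_diff tendsto_const tendsto_rabs u) auto
    qed (use ineq in auto)
  qed
  have eq: "p_laplacian p u x + S * u x powr (q - 1) = 0" for x
  proof -
    have "\<bar>u x\<bar> powr (q - 2) * u x = u x powr (q - 1)"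
      using u_nonneg[of x] powr_add[of "u x" "q - 2" 1] by (cases "u x = 0") auto
    then show ?thesis using EL[of x] by simp
  qed
  have "0 < u x" for x
  proof (rule strong_maximum_principle[of u p])
    fix x
    show "0 \<le> u x" by (rule u_nonneg)
    have "0 \<le> S * u x powr (q - 1)" using S by simp
    then show "p_laplacian p u x \<le> 0" using eq[of x] by linarith
  qed (rule u0)
  then show ?thesis using that[OF S _ eq] by blast
qed

text \<open>
  The two terms of the equation scale with different exponents \<open>p - 1\<close> and \<open>q - 1\<close>, so a
  suitable multiple of the solution absorbs the multiplier.
\<close>

lemma p_laplacian_solution:
  fixes p q :: real
  defines "N \<equiv> real CARD('n::finite)"
  assumes p: "1 < p" "p < N" and q: "N * p / (N - p) < q"
  obtains u :: "int ^ 'n \<Rightarrow> real" where "\<And>x. 0 < u x"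
    "\<And>x. p_laplacian p u x + u x powr (q - 1) = 0"
proof -
  obtain S and u :: "int ^ 'n \<Rightarrow> real" where S: "0 < S" and u: "\<And>x. 0 < u x"
    and eq: "\<And>x. p_laplacian p u x + S * u x powr (q - 1) = 0"
    using p_laplacian_solution_with_multiplier[where 'n = 'n, of p q] p q unfolding N_def by blast
  have "p < N * p / (N - p)" using p by (simp add: field_simps)
  then have pq: "p < q" using q by simp
  define c where "c = S powr (1 / (q - p))"
  have c: "0 < c" using S by (simp add: c_def)
  have "c powr (q - p) = S" using S pq by (simp add: c_def powr_powr)
  then have cS: "c powr (q - 1) = c powr (p - 1) * S"
    using powr_add[of c "p - 1" "q - p"] by simp
  have "p_laplacian p (\<lambda>x. c * u x) x + (c * u x) powr (q - 1) = 0" for x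
  proof -
    have "p_laplacian p (\<lambda>x. c * u x) x + (c * u x) powr (q - 1)
        = c powr (p - 1) * (p_laplacian p u x + S * u x powr (q - 1))"
      using c u[of x] by (simp add: p_laplacian_scale powr_mult cS algebra_simps)
    then show ?thesis by (simp add: eq)
  qed
  then show ?thesis using c u by (intro that[of "\<lambda>x. c * u x"]) auto
qed

theorem corollary4:
  fixes p q :: real
  assumes "CARD('n::finite) \<ge> 3"
    and "1 \<le> p" and "p < real CARD('n)"
    and "q > real CARD('n) * p / (real CARD('n) - p)"
  shows "\<exists>u :: int ^ 'n \<Rightarrow> real.
    (\<forall>x. u x > 0) \<and>
    (p > 1 \<longrightarrow> (\<forall>x. p_laplacian p u x + u x powr (q - 1) = 0)) \<and>
    (p = 1 \<longrightarrow> (\<exists>f. sign_family u f \<and>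
      (\<forall>x. (\<Sum>y | x \<sim>\<^sub>Z y. f x y) + u x powr (q - 1) = 0)))"
proof (cases "p = 1")
  case True
  obtain idx :: "'n \<Rightarrow> nat" where "bij_betw idx UNIV {0..<CARD('n)}"
    using ex_bij_betw_finite_nat[of "UNIV :: 'n set"] by auto
  then interpret ordered_axes idx
    by unfold_locales (simp add: atLeast0LessThan)
  have "1 < real CARD('n) * p / (real CARD('n) - p)"
    using assms(1) True by (simp add: field_simps)
  then have "0 < q - 1" using assms(4) by linarith
  moreover have "2 \<le> CARD('n)" using assms(1) by simp
  ultimately show ?thesis
    using one_laplacian_solution[of "q - 1"] True by (intro exI conjI allI) auto
next
  case False
  then have "1 < p" using assms(2) by simp
  then obtain u :: "int ^ 'n \<Rightarrow> real" where "\<And>x. 0 < u x"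
    "\<And>x. p_laplacian p u x + u x powr (q - 1) = 0"
    using p_laplacian_solution[where 'n = 'n, of p q] assms by blast
  then show ?thesis using False by blast
qed

end
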